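(* Let $P$ be an $SP$-poset. Then for every $n\ge 0$ the coefficient of $x^n$ in $ldd\mathcal{SH}(P)$ is the number of left deck-divider shuffles between $P$ and $\langle n\rangle$.
   Context: Posets are finite. $\langle n\rangle$ is the chain $1<2<\cdots<n$ ($\langle 0\rangle$ is empty). An $SP$-poset is a poset obtained from one-point posets by finitely many applications of disjoint union and ordinal sum. The integers $d_{P,i}$ are defined by $\Omega^\circ(P,x)=\sum_{i=1}^{|P|}d_{P,i}\binom{x}{i}$, where $\Omega^\circ(P,n)$ is the number of strict order-preserving maps $P\to\langle n\rangle$. The left deck-divider shuffle series is $$ldd\mathcal{SH}(P)=\sum_{i=1}^{|P|}d_{P,i}\frac{x^{i+1}}{(1-x)^{i+1}}.$$ A (colimit-indexing) shuffle of $P$ and $\langle n\rangle$ is a finite poset $A$ such that: every point of $A$ is labeled by a point of $P$ or a point of $\langle n\rangle$; $A$ has the same number of minimal points as $P$ and the same number of maximal points as $P$; and there is a bijection $M\mapsto A_M$ from maximal chains of $P$ to maximal chains of $A$ such that the labels along $A_M$ list every element of $M$ and every element of $\langle n\rangle$ exactly once, preserving the order of $M$ and of $\langle n\rangle$. Every point of $P$ labels exactly one point of $A$ (a point of $\langle n\rangle$ may label several), and two shuffles are identified if for every $M$ the label sequences along the corresponding chains coincide. A left deck-divider shuffle between $P$ and $\langle n\rangle$ is a colimit-indexing shuffle $A$ such that for every maximal chain $m\subset A$, the maximum and minimum points of $m$ are points labeled by $\langle n\rangle$, and no two consecutive points of $m$ are labeled by points of $P$. *)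

theory Defs
  imports "HOL-Library.FuncSet" "HOL-Computational_Algebra.Formal_Power_Series"
begin

section \<open>Finite posets\<close>

text \<open>
  A poset is given by its carrier \<open>P\<close> and its (reflexive) order relation \<open>r\<close>, with
  \<open>(x, y) \<in> r\<close> read as \<open>x \<le> y\<close>.
\<close>

definition finite_poset :: "'a set \<Rightarrow> 'a rel \<Rightarrow> bool" where
  "finite_poset P r \<longleftrightarrow> finite P \<and> partial_order_on P r"

text \<open>
  Disjoint union and ordinal sum are internal: the summands are disjoint subsets of one type.
  Every poset isomorphic to an SP-poset is then itself an SP-poset.
\<close>

inductive sp_poset :: "'a set \<Rightarrow> 'a rel \<Rightarrow> bool" where
  point: "sp_poset {a} {(a, a)}"
| disjoint_union:
    "sp_poset P r \<Longrightarrow> sp_poset Q s \<Longrightarrow> P \<inter> Q = {} \<Longrightarrow> sp_poset (P \<union> Q) (r \<union> s)"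
| ordinal_sum:
    "sp_poset P r \<Longrightarrow> sp_poset Q s \<Longrightarrow> P \<inter> Q = {} \<Longrightarrow> sp_poset (P \<union> Q) (r \<union> s \<union> P \<times> Q)"

definition minimal_points :: "'a set \<Rightarrow> 'a rel \<Rightarrow> 'a set" where
  "minimal_points P r = {x \<in> P. \<forall>y\<in>P. (y, x) \<in> r \<longrightarrow> y = x}"

definition maximal_points :: "'a set \<Rightarrow> 'a rel \<Rightarrow> 'a set" where
  "maximal_points P r = {x \<in> P. \<forall>y\<in>P. (x, y) \<in> r \<longrightarrow> y = x}"

definition maximal_chains :: "'a set \<Rightarrow> 'a rel \<Rightarrow> 'a set set" where
  "maximal_chains P r = {C. pred_on.maxchain P (\<lambda>x y. (x, y) \<in> r) C}"

text \<open>The points of a finite chain \<open>C\<close>, listed from the minimum to the maximum.\<close>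

definition chain_list :: "'a rel \<Rightarrow> 'a set \<Rightarrow> 'a list" where
  "chain_list r C = (THE xs. distinct xs \<and> set xs = C \<and> sorted_wrt (\<lambda>x y. (x, y) \<in> r) xs)"

section \<open>The deck-divider series\<close>

definition strict_maps :: "'a set \<Rightarrow> 'a rel \<Rightarrow> nat \<Rightarrow> ('a \<Rightarrow> nat) set" where
  "strict_maps P r n =
     {f \<in> P \<rightarrow>\<^sub>E {1..n}. \<forall>x\<in>P. \<forall>y\<in>P. (x, y) \<in> r \<and> x \<noteq> y \<longrightarrow> f x < f y}"

text \<open>
  The integers \<open>d i\<close> for \<open>1 \<le> i \<le> |P|\<close>. The values outside that range are normalised to \<open>0\<close>,
  which makes the description determine the function \<open>d\<close> uniquely.
\<close>

definition binomial_coeffs :: "'a set \<Rightarrow> 'a rel \<Rightarrow> nat \<Rightarrow> int" where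
  "binomial_coeffs P r =
     (THE d. (\<forall>i. i \<notin> {1..card P} \<longrightarrow> d i = 0) \<and>
             (\<forall>n. int (card (strict_maps P r n)) = (\<Sum>i=1..card P. d i * int (n choose i))))"

definition ldd_series :: "'a set \<Rightarrow> 'a rel \<Rightarrow> rat fps" where
  "ldd_series P r =
     (\<Sum>i=1..card P. of_int (binomial_coeffs P r i) * (fps_X ^ (i + 1) / (1 - fps_X) ^ (i + 1)))"

section \<open>Shuffles of a poset with the chain \<open>1 < \<dots> < n\<close>\<close>

text \<open>
  A candidate shuffle consists of the carrier, the order and the labelling of a poset \<open>A\<close>. The
  label \<open>Inl p\<close> is the point \<open>p\<close> of \<open>P\<close>, and \<open>Inr k\<close> is the point \<open>k\<close> of the chain. As shuffles
  are finite and are counted up to identification of their label sequences, nothing is lost by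
  taking the points of \<open>A\<close> to be natural numbers.
\<close>

type_synonym 'a labelled_poset = "nat set \<times> nat rel \<times> (nat \<Rightarrow> 'a + nat)"

fun points :: "'a labelled_poset \<Rightarrow> nat set" where
  "points (A, s, l) = A"

fun order_rel :: "'a labelled_poset \<Rightarrow> nat rel" where
  "order_rel (A, s, l) = s"

fun label :: "'a labelled_poset \<Rightarrow> nat \<Rightarrow> 'a + nat" where
  "label (A, s, l) = l"

definition chains_of :: "'a labelled_poset \<Rightarrow> nat set set" where
  "chains_of S = maximal_chains (points S) (order_rel S)"

definition label_seq :: "'a labelled_poset \<Rightarrow> nat set \<Rightarrow> ('a + nat) list" where
  "label_seq S m = map (label S) (chain_list (order_rel S) m)"

text \<open>
  \<open>\<phi>\<close> is the bijection \<open>M \<mapsto> A\<^sub>M\<close>. The elements of \<open>shuffles xs ys\<close> are the interleavings of \<open>xs\<close>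
  and \<open>ys\<close>: each entry of either list is used exactly once and both orders are preserved.
\<close>

definition chain_bijection ::
    "'a set \<Rightarrow> 'a rel \<Rightarrow> nat \<Rightarrow> 'a labelled_poset \<Rightarrow> ('a set \<Rightarrow> nat set) \<Rightarrow> bool" where
  "chain_bijection P r n S \<phi> \<longleftrightarrow>
     bij_betw \<phi> (maximal_chains P r) (chains_of S) \<and>
     (\<forall>M \<in> maximal_chains P r.
        label_seq S (\<phi> M) \<in> shuffles (map Inl (chain_list r M)) (map Inr [1..<Suc n]))"

definition colimit_shuffle :: "'a set \<Rightarrow> 'a rel \<Rightarrow> nat \<Rightarrow> 'a labelled_poset \<Rightarrow> bool" where
  "colimit_shuffle P r n S \<longleftrightarrow>
     finite_poset (points S) (order_rel S) \<and>
     label S ` points S \<subseteq> P <+> {1..n} \<and>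
     card (minimal_points (points S) (order_rel S)) = card (minimal_points P r) \<and>
     card (maximal_points (points S) (order_rel S)) = card (maximal_points P r) \<and>
     (\<exists>\<phi>. chain_bijection P r n S \<phi>) \<and>
     (\<forall>p\<in>P. \<exists>!a. a \<in> points S \<and> label S a = Inl p)"

definition ldd_shuffles :: "'a set \<Rightarrow> 'a rel \<Rightarrow> nat \<Rightarrow> 'a labelled_poset set" where
  "ldd_shuffles P r n =
     {S. colimit_shuffle P r n S \<and>
         (\<forall>m \<in> chains_of S.
            label_seq S m \<noteq> [] \<and>
            \<not> isl (hd (label_seq S m)) \<and>
            \<not> isl (last (label_seq S m)) \<and>
            successively (\<lambda>a b. \<not> (isl a \<and> isl b)) (label_seq S m))}"

definition identified :: "'a set \<Rightarrow> 'a rel \<Rightarrow> nat \<Rightarrow> 'a labelled_poset rel" where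
  "identified P r n =
     {(S, T). colimit_shuffle P r n S \<and> colimit_shuffle P r n T \<and>
        (\<exists>\<phi> \<psi>. chain_bijection P r n S \<phi> \<and> chain_bijection P r n T \<psi> \<and>
               (\<forall>M \<in> maximal_chains P r. label_seq S (\<phi> M) = label_seq T (\<psi> M)))}"

section \<open>Well-definedness\<close>

lemma sp_poset_finite_poset: "sp_poset P r \<Longrightarrow> finite_poset P r \<and> P \<noteq> {}"
proof (induction rule: sp_poset.induct)
  case (point a)
  then show ?case
    by (auto simp: finite_poset_def order_on_defs refl_on_def trans_def antisym_def)
next
  case (disjoint_union P r Q s)
  then have sub: "r \<subseteq> P \<times> P" "s \<subseteq> Q \<times> Q" and "refl_on P r" "refl_on Q s"
    and tr: "trans r" "trans s" and anti: "antisym r" "antisym s" and "finite (P \<union> Q)"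
    by (auto simp: finite_poset_def order_on_defs)
  moreover have "refl_on (P \<union> Q) (r \<union> s)"
    using \<open>refl_on P r\<close> \<open>refl_on Q s\<close> by (auto simp: refl_on_def)
  moreover have "trans (r \<union> s)"
    using sub \<open>P \<inter> Q = {}\<close> transD[OF tr(1)] transD[OF tr(2)] by (intro transI) blast
  moreover have "antisym (r \<union> s)"
    using sub \<open>P \<inter> Q = {}\<close> antisymD[OF anti(1)] antisymD[OF anti(2)] by (intro antisymI) blast
  ultimately show ?case
    using disjoint_union.IH by (auto simp: finite_poset_def order_on_defs)
next
  case (ordinal_sum P r Q s)
  then have sub: "r \<subseteq> P \<times> P" "s \<subseteq> Q \<times> Q" and "refl_on P r" "refl_on Q s"
    and tr: "trans r" "trans s" and anti: "antisym r" "antisym s" and "finite (P \<union> Q)"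
    by (auto simp: finite_poset_def order_on_defs)
  moreover have "refl_on (P \<union> Q) (r \<union> s \<union> P \<times> Q)"
    using \<open>refl_on P r\<close> \<open>refl_on Q s\<close> by (auto simp: refl_on_def)
  moreover have "trans (r \<union> s \<union> P \<times> Q)"
    using sub \<open>P \<inter> Q = {}\<close> transD[OF tr(1)] transD[OF tr(2)] by (intro transI) blast
  moreover have "antisym (r \<union> s \<union> P \<times> Q)"
    using sub \<open>P \<inter> Q = {}\<close> antisymD[OF anti(1)] antisymD[OF anti(2)] by (intro antisymI) blast
  ultimately show ?case
    using ordinal_sum.IH by (auto simp: finite_poset_def order_on_defs)
qed

lemma binomial_coeffs_unique:
  fixes d e :: "nat \<Rightarrow> int"
  assumes "\<And>n. (\<Sum>i=1..N. d i * int (n choose i)) = (\<Sum>i=1..N. e i * int (n choose i))"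
    and "1 \<le> k" "k \<le> N"
  shows "d k = e k"
  using assms(2,3)
proof (induction k rule: less_induct)
  case (less k)
  have split: "(\<Sum>i=1..N. c i * int (k choose i)) = (\<Sum>i=1..<k. c i * int (k choose i)) + c k"
    for c :: "nat \<Rightarrow> int"
  proof -
    have "(\<Sum>i=1..N. c i * int (k choose i)) = (\<Sum>i=1..k. c i * int (k choose i))"
      using less.prems by (intro sum.mono_neutral_right) auto
    also have "\<dots> = (\<Sum>i=1..<k. c i * int (k choose i)) + c k"
      using less.prems by (simp add: sum.last_plus)
    finally show ?thesis .
  qed
  have "(\<Sum>i=1..<k. d i * int (k choose i)) = (\<Sum>i=1..<k. e i * int (k choose i))"
    using less by (intro sum.cong) auto
  then show ?case
    using assms(1)[of k] unfolding split by simp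
qed

lemma chain_list:
  assumes "finite_poset P r" "C \<in> maximal_chains P r"
  shows "distinct (chain_list r C)" "set (chain_list r C) = C"
    "sorted_wrt (\<lambda>x y. (x, y) \<in> r) (chain_list r C)"
proof -
  have po: "finite P" "refl_on P r" "trans r" "antisym r"
    using assms(1) by (auto simp: finite_poset_def order_on_defs)
  have ch: "C \<subseteq> P" "\<forall>x\<in>C. \<forall>y\<in>C. (x, y) \<in> r \<or> (y, x) \<in> r"
    using assms(2) \<open>refl_on P r\<close>
    by (auto simp: maximal_chains_def pred_on.maxchain_def pred_on.chain_def refl_on_def)
  have "finite C" using ch po finite_subset by blast
  then have "\<exists>xs. distinct xs \<and> set xs = C \<and> sorted_wrt (\<lambda>x y. (x, y) \<in> r) xs"
    using ch(2)
  proof (induction "card C" arbitrary: C)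
    case 0
    then show ?case by (intro exI[of _ "[]"]) auto
  next
    case (Suc k)
    have "\<exists>x\<in>C. \<forall>y\<in>C. (x, y) \<in> r"
      if "finite C" "C \<noteq> {}" "\<forall>x\<in>C. \<forall>y\<in>C. (x, y) \<in> r \<or> (y, x) \<in> r" for C
      using that
    proof (induction C rule: finite_ne_induct)
      case (singleton x)
      then show ?case by auto
    next
      case (insert x F)
      then obtain m where m: "m \<in> F" "\<forall>y\<in>F. (m, y) \<in> r" by auto
      show ?case
      proof (cases "(x, m) \<in> r")
        case True
        then have "\<forall>y\<in>insert x F. (x, y) \<in> r"
          using m insert.prems transD[OF po(3)] by blast
        then show ?thesis by blast
      next
        case False
        then have "(m, x) \<in> r" using m insert.prems by blast
        then show ?thesis using m by blast
      qed
    qed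
    then obtain x where x: "x \<in> C" "\<forall>y\<in>C. (x, y) \<in> r"
      using Suc by (metis card.empty nat.distinct(1))
    have "k = card (C - {x})" "finite (C - {x})" using Suc x by auto
    moreover have "\<forall>u\<in>C - {x}. \<forall>v\<in>C - {x}. (u, v) \<in> r \<or> (v, u) \<in> r" using Suc by auto
    ultimately obtain xs where
      "distinct xs \<and> set xs = C - {x} \<and> sorted_wrt (\<lambda>x y. (x, y) \<in> r) xs"
      using Suc.hyps(1) by blast
    then show ?case using x by (intro exI[of _ "x # xs"]) auto
  qed
  moreover have "xs = ys"
    if "distinct xs \<and> set xs = C \<and> sorted_wrt (\<lambda>x y. (x, y) \<in> r) xs"
      "distinct ys \<and> set ys = C \<and> sorted_wrt (\<lambda>x y. (x, y) \<in> r) ys" for xs ys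
    using that
  proof (induction xs arbitrary: ys C)
    case Nil
    then show ?case by auto
  next
    case (Cons x xs)
    then obtain y ys' where ys: "ys = y # ys'" by (cases ys) auto
    have "x = y"
    proof (rule ccontr)
      assume "x \<noteq> y"
      then have "y \<in> set xs" "x \<in> set ys'" using Cons.prems ys by auto
      then have "(x, y) \<in> r" "(y, x) \<in> r" using Cons.prems ys by auto
      then show False using \<open>x \<noteq> y\<close> antisymD[OF po(4)] by blast
    qed
    moreover have "set xs = C - {x}" "set ys' = C - {y}" using Cons.prems ys by auto
    ultimately show ?case using Cons.IH[of "C - {x}" ys'] Cons.prems ys by auto
  qed
  ultimately have "\<exists>!xs. distinct xs \<and> set xs = C \<and> sorted_wrt (\<lambda>x y. (x, y) \<in> r) xs"
    by blast
  from theI'[OF this]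
  show "distinct (chain_list r C)" "set (chain_list r C) = C"
    "sorted_wrt (\<lambda>x y. (x, y) \<in> r) (chain_list r C)"
    unfolding chain_list_def by auto
qed

lemma chain_bijection_unique:
  assumes "finite_poset P r" "chain_bijection P r n S \<phi>" "chain_bijection P r n S \<psi>"
    and M: "M \<in> maximal_chains P r"
  shows "\<phi> M = \<psi> M"
proof -
  have content: "Inl -` set (label_seq S (\<chi> N)) = N"
    if "chain_bijection P r n S \<chi>" "N \<in> maximal_chains P r" for \<chi> N
  proof -
    have "label_seq S (\<chi> N) \<in> shuffles (map Inl (chain_list r N)) (map Inr [1..<Suc n])"
      using that by (auto simp: chain_bijection_def)
    from set_shuffles[OF this] show ?thesis
      using chain_list(2)[OF assms(1) that(2)] by auto
  qed
  have "\<phi> M \<in> \<psi> ` maximal_chains P r"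
    using assms M by (auto simp: chain_bijection_def bij_betw_def)
  then obtain N where N: "N \<in> maximal_chains P r" "\<phi> M = \<psi> N" by auto
  then have "M = N" using content[OF assms(2) M] content[OF assms(3) N(1)] by simp
  then show ?thesis using N by simp
qed

lemma equiv_identified:
  assumes "finite_poset P r"
  shows "equiv {S. colimit_shuffle P r n S} (identified P r n)"
proof (intro equivI)
  show "identified P r n \<subseteq> {S. colimit_shuffle P r n S} \<times> {S. colimit_shuffle P r n S}"
    by (auto simp: identified_def)
  show "refl_on {S. colimit_shuffle P r n S} (identified P r n)"
    by (auto simp: refl_on_def identified_def colimit_shuffle_def)
  show "sym (identified P r n)"
    unfolding sym_def identified_def by (clarsimp, metis)
  show "trans (identified P r n)"
  proof (rule transI)
    fix S T U assume "(S, T) \<in> identified P r n" "(T, U) \<in> identified P r n"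
    then obtain \<phi> \<psi> \<psi>' \<chi> where
      *: "chain_bijection P r n S \<phi>" "chain_bijection P r n T \<psi>"
      "chain_bijection P r n T \<psi>'" "chain_bijection P r n U \<chi>"
      "\<forall>M \<in> maximal_chains P r. label_seq S (\<phi> M) = label_seq T (\<psi> M)"
      "\<forall>M \<in> maximal_chains P r. label_seq T (\<psi>' M) = label_seq U (\<chi> M)"
      and cs: "colimit_shuffle P r n S" "colimit_shuffle P r n U"
      unfolding identified_def by blast
    have "\<forall>M \<in> maximal_chains P r. label_seq S (\<phi> M) = label_seq U (\<chi> M)"
      using * chain_bijection_unique[OF assms *(2,3)] by simp
    then show "(S, U) \<in> identified P r n" unfolding identified_def using * cs by blast
  qed
qed

end

theory Submission
  imports Defs "HOL-Library.Infinite_Set"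
begin

text \<open>
  The coefficient of \<open>x\<^sup>n\<close> in \<open>x\<^sup>i\<^sup>+\<^sup>1 / (1 - x)\<^sup>i\<^sup>+\<^sup>1\<close> is \<open>(n - 1) choose i\<close> (and \<open>0\<close> for \<open>n = 0\<close>), so
  the coefficient of \<open>x\<^sup>n\<close> in the series is the number of strict maps \<open>f\<close> from \<open>P\<close> to
  \<open>{1..n - 1}\<close>. A shuffle corresponds to the map \<open>f\<close> that sends \<open>p\<close> to the number of chain labels
  below the point labelled \<open>p\<close>. This number is the same along all maximal chains through that
  point, because two such chains can be spliced there. The deck-divider conditions say exactly that
  \<open>f\<close> is strict with values in \<open>{1..n - 1}\<close>. Conversely, a poset with prescribed \<open>f\<close> is built along
  the construction of the SP-poset; for an ordinal sum of \<open>P\<close> and \<open>Q\<close> one puts a single point with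
  label \<open>Max (f ` P) + 1\<close> between the poset for \<open>P\<close> and the poset for \<open>Q\<close>, which keeps the maximal
  chains of the result in bijection with pairs of maximal chains.
\<close>

section \<open>Label sequences\<close>

text \<open>If \<open>f\<close> is weakly increasing along \<open>xs\<close> with values from
  \<open>a\<close> to \<open>b\<close>, this is the interleaving of \<open>xs\<close> with the chain
  labels \<open>a + 1, ..., b\<close> in which exactly the labels up to \<open>f x\<close> precede
  \<open>x\<close>. The argument \<open>a\<close> counts the chain labels already placed.\<close>

fun deck_word :: "('a \<Rightarrow> nat) \<Rightarrow> nat \<Rightarrow> nat \<Rightarrow> 'a list \<Rightarrow> ('a + nat) list" where
  "deck_word f a b [] = map Inr [Suc a..<Suc b]"
| "deck_word f a b (x # xs) = map Inr [Suc a..<Suc (f x)] @ Inl x # deck_word f (f x) b xs"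

lemma deck_word_Cons_Inr:
  assumes "xs = [] \<Longrightarrow> a < b" "xs \<noteq> [] \<Longrightarrow> a < f (hd xs)"
  shows "deck_word f a b xs = Inr (Suc a) # deck_word f (Suc a) b xs"
proof -
  have "map Inr [Suc a..<Suc c] = Inr (Suc a) # map Inr [Suc (Suc a)..<Suc c]"
    if "a < c" for c
    using that by (simp add: upt_conv_Cons del: upt_Suc)
  then show ?thesis
    using assms by (cases xs) (auto simp del: upt_Suc)
qed

lemma deck_word_append_upt:
  assumes "a \<le> c" "c \<le> b" "\<And>x. x \<in> set xs \<Longrightarrow> c \<le> f x"
  shows "deck_word f a b xs = map Inr [Suc a..<Suc c] @ deck_word f c b xs"
proof -
  have upt: "[Suc a..<Suc d] = [Suc a..<Suc c] @ [Suc c..<Suc d]" if "c \<le> d" for d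
    using upt_add_eq_append[of "Suc a" "Suc c" "d - c"] assms(1) that by simp
  show ?thesis
  proof (cases xs)
    case Nil
    then show ?thesis using upt[OF assms(2)] by (simp del: upt_Suc)
  next
    case (Cons x ys)
    then show ?thesis using upt[of "f x"] assms(3)[of x] by (simp del: upt_Suc)
  qed
qed

text \<open>The word-level counterpart of an ordinal sum. Label \<open>Suc c\<close> comes after
  every entry of \<open>xs\<close>, whose values are at most \<open>c\<close>, and before every
  entry of \<open>ys\<close>, whose values exceed \<open>c\<close>, so the word factors at this
  label.\<close>

lemma deck_word_append:
  assumes "a \<le> c" "c < b" "\<And>x. x \<in> set xs \<Longrightarrow> f x \<le> c" "\<And>y. y \<in> set ys \<Longrightarrow> c < f y"
  shows "deck_word f a b (xs @ ys) = deck_word f a c xs @ Inr (Suc c) # deck_word f (Suc c) b ys"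
  using assms
proof (induction xs arbitrary: a)
  case Nil
  have "deck_word f a b ys = map Inr [Suc a..<Suc c] @ deck_word f c b ys"
    using Nil by (intro deck_word_append_upt) (auto simp: less_imp_le)
  also have "deck_word f c b ys = Inr (Suc c) # deck_word f (Suc c) b ys"
    using Nil by (intro deck_word_Cons_Inr) auto
  finally show ?case by simp
next
  case (Cons x xs)
  then show ?case by simp
qed

text \<open>Between consecutive points \<open>x\<close> and \<open>y\<close> stands the block of
  labels from \<open>f x + 1\<close> to \<open>f y\<close>, which is empty exactly if
  \<open>f x < f y\<close> fails. All other adjacent pairs contain a chain label.\<close>

lemma successively_deck_word:
  "successively (\<lambda>u v. \<not> (isl u \<and> isl v)) (deck_word f a b xs) \<longleftrightarrow>
   successively (\<lambda>x y. f x < f y) xs"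
proof (induction xs arbitrary: a)
  case Nil
  then show ?case by (auto simp: successively_conv_nth)
next
  case (Cons x xs)
  have upt: "successively (\<lambda>u v :: 'a + nat. \<not> (isl u \<and> isl v)) (map Inr ks)" for ks
    by (auto simp: successively_conv_nth)
  have last: "map Inr ks \<noteq> [] \<Longrightarrow> \<not> isl (last (map Inr ks :: ('a + nat) list))" for ks
    by (simp add: last_map)
  show ?case
  proof (cases xs)
    case Nil
    have hd: "map Inr ks \<noteq> [] \<Longrightarrow> \<not> isl (hd (map Inr ks :: ('a + nat) list))" for ks
      by (simp add: hd_map)
    show ?thesis
      using upt hd last by (auto simp: Nil successively_append_iff successively_Cons simp del: upt_Suc)
  next
    case (Cons y ys)
    have hd: "isl (hd (deck_word f (f x) b xs)) \<longleftrightarrow> \<not> f x < f y"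
      using Cons by (cases "f x < f y") (auto simp: upt_conv_Cons simp del: upt_Suc)
    have "successively (\<lambda>u v. \<not> (isl u \<and> isl v)) (deck_word f a b (x # xs)) \<longleftrightarrow>
        successively (\<lambda>u v. \<not> (isl u \<and> isl v)) (Inl x # deck_word f (f x) b xs)"
      using upt last by (auto simp: successively_append_iff simp del: upt_Suc)
    also have "\<dots> \<longleftrightarrow> f x < f y \<and> successively (\<lambda>x y. f x < f y) xs"
      using Cons.IH hd by (simp add: successively_Cons Cons del: upt_Suc)
    finally show ?thesis by (simp add: Cons)
  qed
qed

lemma deck_word_nonempty: "xs \<noteq> [] \<Longrightarrow> deck_word f a b xs \<noteq> []"
  by (cases xs) auto

lemma isl_hd_deck_word:
  "xs \<noteq> [] \<Longrightarrow> isl (hd (deck_word f a b xs)) \<longleftrightarrow> \<not> a < f (hd xs)"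
  by (cases xs; cases "a < f (hd xs)") (auto simp: upt_conv_Cons simp del: upt_Suc)

lemma isl_last_deck_word:
  "xs \<noteq> [] \<Longrightarrow> isl (last (deck_word f a b xs)) \<longleftrightarrow> \<not> f (last xs) < b"
proof (induction xs arbitrary: a)
  case (Cons x xs)
  then show ?case
    by (cases xs) (auto simp: last_map deck_word_nonempty)
qed simp

lemma append_in_shuffles_right: "zs \<in> shuffles xs ys \<Longrightarrow> us @ zs \<in> shuffles xs (us @ ys)"
  by (induction us) (auto intro: Cons_in_shuffles_rightI)

text \<open>Monotonicity and the bounds make each block of chain labels start where the previous one
  stopped, so the blocks join to \<open>[Suc a..<Suc b]\<close> without gap or repetition.\<close>

lemma deck_word_in_shuffles:
  assumes "a \<le> b" "\<And>x. x \<in> set xs \<Longrightarrow> a \<le> f x \<and> f x \<le> b" "sorted_wrt (\<lambda>x y. f x \<le> f y) xs"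
  shows "deck_word f a b xs \<in> shuffles (map Inl xs) (map Inr [Suc a..<Suc b])"
  using assms
proof (induction xs arbitrary: a)
  case (Cons x xs)
  have "deck_word f (f x) b xs \<in> shuffles (map Inl xs) (map Inr [Suc (f x)..<Suc b])"
    using Cons.prems by (intro Cons.IH) auto
  then have "map Inr [Suc a..<Suc (f x)] @ Inl x # deck_word f (f x) b xs
      \<in> shuffles (Inl x # map Inl xs) (map Inr [Suc a..<Suc (f x)] @ map Inr [Suc (f x)..<Suc b])"
    by (intro append_in_shuffles_right Cons_in_shuffles_leftI)
  moreover have "[Suc a..<Suc b] = [Suc a..<Suc (f x)] @ [Suc (f x)..<Suc b]"
    using upt_add_eq_append[of "Suc a" "Suc (f x)" "b - f x"] Cons.prems by simp
  ultimately show ?case by simp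
qed simp

text \<open>The length of the block of chain labels before the first point reveals the value there;
  the rest of the word is then again a deck word, with that value as its new start.\<close>

lemma deck_word_inject:
  assumes "deck_word f a b xs = deck_word g a b xs"
    and "sorted_wrt (\<lambda>x y. f x \<le> f y) xs" "sorted_wrt (\<lambda>x y. g x \<le> g y) xs"
    and "\<And>x. x \<in> set xs \<Longrightarrow> a \<le> f x \<and> a \<le> g x"
    and "x \<in> set xs"
  shows "f x = g x"
  using assms
proof (induction xs arbitrary: a)
  case (Cons y ys)
  have tw: "takeWhile (\<lambda>u. \<not> isl u) (deck_word h a b (y # ys)) = map Inr [Suc a..<Suc (h y)]" for h
    by (subst deck_word.simps, subst takeWhile_append2) auto
  have "[Suc a..<Suc (f y)] = [Suc a..<Suc (g y)]"
    using tw[of f] tw[of g] Cons.prems(1)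
    by (metis inj_Inr inj_map_eq_map)
  then have "length [Suc a..<Suc (f y)] = length [Suc a..<Suc (g y)]" by (rule arg_cong)
  \<comment> \<open>Subtraction is truncated, so equal lengths yield equal values only together with
    the lower bound \<open>a\<close> for both maps.\<close>
  then have "f y - a = g y - a" by (simp del: upt_Suc)
  moreover have "a \<le> f y" "a \<le> g y" using Cons.prems(4)[of y] by auto
  ultimately have eq: "f y = g y" by linarith
  moreover have "x \<in> set ys \<Longrightarrow> f x = g x"
    using Cons.prems eq by (intro Cons.IH[of "f y"]) auto
  ultimately show ?case using Cons.prems(5) by auto
qed simp

section \<open>Recovering the map from an interleaving\<close>

definition deck_position :: "('a + nat) list \<Rightarrow> 'a \<Rightarrow> nat" where
  "deck_position w x = length (filter (\<lambda>u. \<not> isl u) (takeWhile (\<lambda>u. u \<noteq> Inl x) w))"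

lemma deck_word_cong:
  "(\<And>x. x \<in> set xs \<Longrightarrow> f x = g x) \<Longrightarrow> deck_word f a b xs = deck_word g a b xs"
  by (induction xs arbitrary: a) auto

text \<open>An interleaving is determined by how many chain labels precede each point. In the
  induction on the word, \<open>a\<close> stands for the chain labels already removed from its
  front.\<close>

lemma shuffles_eq_deck_word:
  assumes "w \<in> shuffles (map Inl xs) (map Inr [Suc a..<Suc b])" "distinct xs"
  shows "w = deck_word (\<lambda>x. a + deck_position w x) a b xs"
  using assms
proof (induction w arbitrary: xs a)
  case Nil
  then show ?case by (auto simp del: upt_Suc)
next
  case (Cons u w)
  show ?case
  proof (cases u)
    case (Inl x)
    with Cons.prems obtain xs' where xs: "xs = x # xs'"
      and w: "w \<in> shuffles (map Inl xs') (map Inr [Suc a..<Suc b])"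
      unfolding Cons_in_shuffles_iff by (cases xs; cases "[Suc a..<Suc b]") (auto simp del: upt_Suc)
    have "w = deck_word (\<lambda>x. a + deck_position w x) a b xs'"
      using Cons.prems w by (intro Cons.IH) (auto simp: xs)
    \<comment> \<open>By distinctness \<open>x\<close> does not occur in \<open>xs'\<close>, so
      putting \<open>Inl x\<close> in front changes no position of a later point.\<close>
    also have "\<dots> = deck_word (\<lambda>y. a + deck_position (u # w) y) a b xs'"
      using Cons.prems(2) by (intro deck_word_cong) (auto simp: xs Inl deck_position_def)
    finally show ?thesis by (simp add: xs Inl deck_position_def)
  next
    case (Inr k)
    have "hd (map Inl xs) \<noteq> u" if "xs \<noteq> []"
      using that Inr by (cases xs) auto
    with Cons.prems(1) have *: "map Inr [Suc a..<Suc b] \<noteq> []" "hd (map Inr [Suc a..<Suc b]) = u"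
      "w \<in> shuffles (map Inl xs) (tl (map Inr [Suc a..<Suc b]))"
      unfolding Cons_in_shuffles_iff by blast+
    from *(1) have "a < b" by (simp del: upt_Suc)
    then have upt: "[Suc a..<Suc b] = Suc a # [Suc (Suc a)..<Suc b]"
      by (simp add: upt_conv_Cons del: upt_Suc)
    have "k = Suc a" and w: "w \<in> shuffles (map Inl xs) (map Inr [Suc (Suc a)..<Suc b])"
      using *(2,3) Inr unfolding upt by (simp_all del: upt_Suc)
    have "w = deck_word (\<lambda>x. Suc a + deck_position w x) (Suc a) b xs"
      using Cons.prems w by (intro Cons.IH)
    \<comment> \<open>The chain label at the front raises every position by one, which compensates
      for the shift from \<open>Suc a\<close> to \<open>a\<close>. All positions are now positive,
      so a deck word started at \<open>a\<close> begins with \<open>Suc a\<close>.\<close>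
    also have "\<dots> = deck_word (\<lambda>y. a + deck_position (u # w) y) (Suc a) b xs"
      by (intro deck_word_cong) (auto simp: Inr deck_position_def)
    finally have "u # w = Inr (Suc a) # \<dots>" using Inr \<open>k = Suc a\<close> by simp
    also have "\<dots> = deck_word (\<lambda>y. a + deck_position (u # w) y) a b xs"
      using \<open>a < b\<close> by (intro deck_word_Cons_Inr[symmetric]) (auto simp: Inr deck_position_def)
    finally show ?thesis .
  qed
qed

section \<open>The coefficients of the series\<close>

text \<open>The series \<open>A i\<close> with the claimed coefficients satisfies
  \<open>(1 - fps_X) * A (Suc i) = fps_X * A i\<close>, which is Pascal's rule. Iterating gives
  \<open>(1 - fps_X) ^ Suc i * A i = fps_X ^ Suc i\<close>, and the power of
  \<open>1 - fps_X\<close> is cancelled because its constant coefficient is nonzero.\<close>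

lemma X_over_one_minus_X_power_nth:
  "fps_nth (fps_X ^ Suc i / (1 - fps_X) ^ Suc i :: 'a :: field fps) n =
     (if n = 0 then 0 else of_nat ((n - 1) choose i))"
proof -
  define A :: "nat \<Rightarrow> 'a fps" where
    "A = (\<lambda>i. Abs_fps (\<lambda>n. if n = 0 then 0 else of_nat ((n - 1) choose i)))"
  have A0: "(1 - fps_X) * A 0 = fps_X"
    by (rule fps_ext) (auto simp: A_def left_diff_distrib)
  have A_Suc: "(1 - fps_X) * A (Suc i) = fps_X * A i" for i
  proof (rule fps_ext)
    fix m
    show "fps_nth ((1 - fps_X) * A (Suc i)) m = fps_nth (fps_X * A i) m"
    proof (cases m)
      case (Suc k)
      then show ?thesis by (cases k) (auto simp: A_def left_diff_distrib)
    qed (simp add: A_def)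
  qed
  have "(1 - fps_X) ^ Suc i * A i = fps_X ^ Suc i"
  proof (induction i)
    case (Suc i)
    have "(1 - fps_X) ^ Suc (Suc i) * A (Suc i) = (1 - fps_X) ^ Suc i * ((1 - fps_X) * A (Suc i))"
      by (simp add: mult_ac)
    also have "\<dots> = fps_X * ((1 - fps_X) ^ Suc i * A i)"
      unfolding A_Suc by (simp add: mult_ac)
    finally show ?case unfolding Suc by simp
  qed (simp add: A0)
  moreover have "fps_nth ((1 - fps_X) ^ Suc i :: 'a fps) 0 \<noteq> 0"
    by (simp add: fps_nth_power_0)
  ultimately have "fps_X ^ Suc i / (1 - fps_X) ^ Suc i = A i"
    using nonzero_mult_div_cancel_left[of "(1 - fps_X) ^ Suc i" "A i"] by auto
  then show ?thesis by (simp add: A_def)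
qed

section \<open>Counting strict maps by their image\<close>

text \<open>Fixing the exact image makes the binomial expansion visible: the number of strict maps
  onto an \<open>i\<close>-element set turns out to be the \<open>i\<close>-th coefficient.\<close>

definition strict_maps_onto :: "'a set \<Rightarrow> 'a rel \<Rightarrow> nat set \<Rightarrow> ('a \<Rightarrow> nat) set" where
  "strict_maps_onto P r I =
     {f \<in> P \<rightarrow>\<^sub>E I. f ` P = I \<and> (\<forall>x\<in>P. \<forall>y\<in>P. (x, y) \<in> r \<and> x \<noteq> y \<longrightarrow> f x < f y)}"

text \<open>Only the order type of the image matters: composition with the increasing bijection
  \<open>h\<close> between \<open>{..<card I}\<close> and \<open>I\<close>, or with its inverse
  \<open>g\<close>, preserves strictness.\<close>

lemma card_strict_maps_onto:
  assumes "finite I"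
  shows "card (strict_maps_onto P r I) = card (strict_maps_onto P r {..<card I})"
proof -
  obtain h where h: "bij_betw h {..<card I} I" "strict_mono_on {..<card I} h"
    using ex_bij_betw_strict_mono_card[OF assms] by blast
  define g where "g = inv_into {..<card I} h"
  have hI: "h ` {..<card I} = I" "inj_on h {..<card I}"
    using h by (auto simp: bij_betw_def)
  have gh: "g (h i) = i" if "i < card I" for i
    using that hI by (simp add: g_def)
  have hg: "g j < card I" "h (g j) = j" if "j \<in> I" for j
    using that hI f_inv_into_f[of j h "{..<card I}"] inv_into_into[of j h "{..<card I}"]
    by (auto simp: g_def)
  have hless: "h i < h j" if "i < j" "j < card I" for i j
    using h(2) that by (auto simp: strict_mono_on_def)
  have gless: "g i < g j" if "i < j" "i \<in> I" "j \<in> I" for i j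
  proof (rule ccontr)
    assume "\<not> g i < g j"
    then consider "g i = g j" | "g j < g i" by linarith
    then show False
      using hless[of "g j" "g i"] hg that by cases (metis less_irrefl, force)
  qed
  \<comment> \<open>The restriction resets the composite to \<open>undefined\<close> outside
    \<open>P\<close>, as membership in an extensional function space demands.\<close>
  have "bij_betw (\<lambda>f. restrict (h \<circ> f) P) (strict_maps_onto P r {..<card I}) (strict_maps_onto P r I)"
  proof (rule bij_betw_byWitness[where f' = "\<lambda>f. restrict (g \<circ> f) P"])
    show "\<forall>f\<in>strict_maps_onto P r {..<card I}. restrict (g \<circ> restrict (h \<circ> f) P) P = f"
    proof (intro ballI ext)
      fix f x assume f: "f \<in> strict_maps_onto P r {..<card I}"
      then show "restrict (g \<circ> restrict (h \<circ> f) P) P x = f x"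
        using gh[of "f x"] by (cases "x \<in> P") (auto simp: strict_maps_onto_def PiE_iff extensional_def)
    qed
    show "\<forall>f\<in>strict_maps_onto P r I. restrict (h \<circ> restrict (g \<circ> f) P) P = f"
    proof (intro ballI ext)
      fix f x assume f: "f \<in> strict_maps_onto P r I"
      then show "restrict (h \<circ> restrict (g \<circ> f) P) P x = f x"
        using hg(2)[of "f x"] by (cases "x \<in> P") (auto simp: strict_maps_onto_def PiE_iff extensional_def)
    qed
    show "(\<lambda>f. restrict (h \<circ> f) P) ` strict_maps_onto P r {..<card I} \<subseteq> strict_maps_onto P r I"
    proof (intro image_subsetI)
      fix f assume f: "f \<in> strict_maps_onto P r {..<card I}"
      then have "f ` P = {..<card I}" and mono: "\<And>x y. x \<in> P \<Longrightarrow> y \<in> P \<Longrightarrow> (x, y) \<in> r \<Longrightarrow> x \<noteq> y \<Longrightarrow> f x < f y"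
        by (auto simp: strict_maps_onto_def)
      moreover have "restrict (h \<circ> f) P ` P = h ` f ` P"
        by (simp add: image_comp cong: image_cong_simp)
      ultimately have "restrict (h \<circ> f) P ` P = I" using hI by simp
      moreover have "restrict (h \<circ> f) P x < restrict (h \<circ> f) P y"
        if "x \<in> P" "y \<in> P" "(x, y) \<in> r" "x \<noteq> y" for x y
        using hless[OF mono[OF that]] that \<open>f ` P = {..<card I}\<close> by auto
      ultimately show "restrict (h \<circ> f) P \<in> strict_maps_onto P r I"
        by (auto simp: strict_maps_onto_def)
    qed
    show "(\<lambda>f. restrict (g \<circ> f) P) ` strict_maps_onto P r I \<subseteq> strict_maps_onto P r {..<card I}"
    proof (intro image_subsetI)
      fix f assume f: "f \<in> strict_maps_onto P r I"
      then have "f ` P = I" and mono: "\<And>x y. x \<in> P \<Longrightarrow> y \<in> P \<Longrightarrow> (x, y) \<in> r \<Longrightarrow> x \<noteq> y \<Longrightarrow> f x < f y"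
        by (auto simp: strict_maps_onto_def)
      moreover have "restrict (g \<circ> f) P ` P = g ` f ` P"
        by (simp add: image_comp cong: image_cong_simp)
      moreover have "g ` I = {..<card I}"
        using bij_betw_inv_into[OF h(1)] by (simp add: bij_betw_def g_def)
      ultimately have "restrict (g \<circ> f) P ` P = {..<card I}" by simp
      moreover have "restrict (g \<circ> f) P x < restrict (g \<circ> f) P y"
        if "x \<in> P" "y \<in> P" "(x, y) \<in> r" "x \<noteq> y" for x y
        using gless[OF mono[OF that]] that \<open>f ` P = I\<close> by auto
      ultimately show "restrict (g \<circ> f) P \<in> strict_maps_onto P r {..<card I}"
        by (auto simp: strict_maps_onto_def)
    qed
  qed
  then show ?thesis by (rule bij_betw_same_card[symmetric])
qed

lemma finite_strict_maps: "finite P \<Longrightarrow> finite (strict_maps P r n)"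
  unfolding strict_maps_def by (rule finite_subset[OF _ finite_PiE[of P "\<lambda>_. {1..n}"]]) auto

text \<open>The strict maps are partitioned by their image, and among the subsets of
  \<open>{1..n}\<close> there are \<open>n choose i\<close> of size \<open>i\<close>, each the image
  of equally many maps.\<close>

lemma card_strict_maps:
  assumes "finite P" "P \<noteq> {}"
  shows "card (strict_maps P r n) =
    (\<Sum>i=1..card P. card (strict_maps_onto P r {..<i}) * (n choose i))"
proof -
  \<comment> \<open>An image has at least one element because \<open>P\<close> is nonempty, and at
    most \<open>card P\<close>; this gives the summation range.\<close>
  let ?J = "{I. I \<subseteq> {1..n} \<and> card I \<in> {1..card P}}"
  have fin: "finite ?J" by (rule finite_subset[of _ "Pow {1..n}"]) auto
  have "strict_maps P r n = (\<Union>I\<in>?J. strict_maps_onto P r I)"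
  proof (intro equalityI subsetI)
    fix f assume f: "f \<in> strict_maps P r n"
    then have "f ` P \<subseteq> {1..n}" by (auto simp: strict_maps_def PiE_iff)
    moreover have "1 \<le> card (f ` P)" using assms by (simp add: Suc_le_eq card_gt_0_iff)
    ultimately have "f ` P \<in> ?J" using assms by (simp add: card_image_le)
    moreover have "f \<in> strict_maps_onto P r (f ` P)"
      using f by (auto simp: strict_maps_def strict_maps_onto_def PiE_iff)
    ultimately show "f \<in> (\<Union>I\<in>?J. strict_maps_onto P r I)" by blast
  next
    fix f assume "f \<in> (\<Union>I\<in>?J. strict_maps_onto P r I)"
    then show "f \<in> strict_maps P r n"
      by (auto simp: strict_maps_def strict_maps_onto_def PiE_iff)
  qed
  moreover have "card (\<Union>I\<in>?J. strict_maps_onto P r I) = (\<Sum>I\<in>?J. card (strict_maps_onto P r I))"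
  proof (rule card_UN_disjoint[OF fin])
    show "\<forall>I\<in>?J. finite (strict_maps_onto P r I)"
    proof
      fix I assume "I \<in> ?J"
      then have "finite (P \<rightarrow>\<^sub>E I)"
        using assms finite_subset[of I "{1..n}"] by (intro finite_PiE) auto
      then show "finite (strict_maps_onto P r I)"
        by (rule rev_finite_subset) (auto simp: strict_maps_onto_def)
    qed
  qed (auto simp: strict_maps_onto_def)
  moreover have "(\<Sum>I\<in>?J. card (strict_maps_onto P r I)) =
      (\<Sum>I\<in>?J. card (strict_maps_onto P r {..<card I}))"
    by (intro sum.cong refl card_strict_maps_onto) (metis (lifting) finite_atLeastAtMost finite_subset mem_Collect_eq)
  moreover have "\<dots> = (\<Sum>i=1..card P. \<Sum>I\<in>{I \<in> ?J. card I = i}. card (strict_maps_onto P r {..<card I}))"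
    using fin by (intro sum.group[symmetric]) auto
  moreover have "\<dots> = (\<Sum>i=1..card P. card (strict_maps_onto P r {..<i}) * (n choose i))"
  proof (intro sum.cong refl)
    fix i assume i: "i \<in> {1..card P}"
    then have "{I \<in> ?J. card I = i} = {I. I \<subseteq> {1..n} \<and> card I = i}" by auto
    then have "card {I \<in> ?J. card I = i} = (n choose i)"
      by (simp add: n_subsets)
    moreover have "(\<Sum>I\<in>{I \<in> ?J. card I = i}. card (strict_maps_onto P r {..<card I})) =
        (\<Sum>I\<in>{I \<in> ?J. card I = i}. card (strict_maps_onto P r {..<i}))"
      by (intro sum.cong) auto
    ultimately show "(\<Sum>I\<in>{I \<in> ?J. card I = i}. card (strict_maps_onto P r {..<card I})) =
        card (strict_maps_onto P r {..<i}) * (n choose i)"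
      by simp
  qed
  ultimately show ?thesis by metis
qed

text \<open>A definite description obeys its defining property only once existence and uniqueness
  are known. The numbers of strict maps onto initial segments give existence; evaluating at
  \<open>n = 1, 2, ...\<close> in turn, as in \<open>binomial_coeffs_unique\<close>, gives
  uniqueness.\<close>

lemma sum_binomial_coeffs:
  assumes "finite P" "P \<noteq> {}"
  shows "(\<Sum>i=1..card P. binomial_coeffs P r i * int (n choose i)) = int (card (strict_maps P r n))"
proof -
  let ?S = "\<lambda>d. (\<forall>i. i \<notin> {1..card P} \<longrightarrow> d i = 0) \<and>
             (\<forall>n. int (card (strict_maps P r n)) = (\<Sum>i=1..card P. d i * int (n choose i)))"
  have "\<exists>!d. ?S d"
  proof (rule ex_ex1I)
    let ?d = "\<lambda>i. if i \<in> {1..card P} then int (card (strict_maps_onto P r {..<i})) else 0"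
    have "?S ?d"
    proof (intro conjI allI impI)
      fix n
      have "int (card (strict_maps P r n)) =
          (\<Sum>i=1..card P. int (card (strict_maps_onto P r {..<i}) * (n choose i)))"
        unfolding card_strict_maps[OF assms] by (rule of_nat_sum)
      also have "\<dots> = (\<Sum>i=1..card P. ?d i * int (n choose i))"
        by (intro sum.cong) simp_all
      finally show "int (card (strict_maps P r n)) = (\<Sum>i=1..card P. ?d i * int (n choose i))" .
    qed auto
    then show "\<exists>d. ?S d" by (rule exI[where x = ?d])
  next
    fix d e assume d: "?S d" and e: "?S e"
    have eq: "(\<Sum>i=1..card P. d i * int (m choose i)) = (\<Sum>i=1..card P. e i * int (m choose i))" for m
      by (rule trans[OF conjunct2[OF d, rule_format, symmetric] conjunct2[OF e, rule_format]])
    show "d = e"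
    proof
      fix i show "d i = e i"
      proof (cases "i \<in> {1..card P}")
        case True
        then show ?thesis using binomial_coeffs_unique[where k = i, OF eq] by simp
      next
        case False
        then show ?thesis
          using conjunct1[OF d, rule_format, of i] conjunct1[OF e, rule_format, of i] by simp
      qed
    qed
  qed
  from conjunct2[OF theI'[OF this]] have "int (card (strict_maps P r n)) =
      (\<Sum>i=1..card P. binomial_coeffs P r i * int (n choose i))"
    unfolding binomial_coeffs_def by (rule spec)
  then show ?thesis by (rule sym)
qed

lemma ldd_series_nth:
  assumes "finite P" "P \<noteq> {}"
  shows "fps_nth (ldd_series P r) n = of_nat (card (strict_maps P r (n - 1)))"
proof -
  have "fps_nth (of_int c * (fps_X ^ (i + 1) / (1 - fps_X) ^ (i + 1)) :: rat fps) n =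
      (if n = 0 then 0 else of_int (c * int ((n - 1) choose i)))" for c i
    unfolding fps_of_int[symmetric] fps_mult_left_const_nth Suc_eq_plus1[symmetric]
      X_over_one_minus_X_power_nth by simp
  then have "fps_nth (ldd_series P r) n =
      (\<Sum>i=1..card P. if n = 0 then 0 else of_int (binomial_coeffs P r i * int ((n - 1) choose i)))"
    unfolding ldd_series_def fps_sum_nth by (intro sum.cong refl)
  also have "\<dots> = (if n = 0 then 0 else
      of_int (\<Sum>i=1..card P. binomial_coeffs P r i * int ((n - 1) choose i)))"
    unfolding of_int_sum by (cases "n = 0") simp_all
  finally have "fps_nth (ldd_series P r) n =
      (if n = 0 then 0 else of_nat (card (strict_maps P r (n - 1))))"
    unfolding sum_binomial_coeffs[OF assms] by simp
  \<comment> \<open>For \<open>n = 0\<close> the truncated \<open>n - 1\<close> is \<open>0\<close>.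
    A nonempty poset has no map into the empty chain, so the count agrees with the vanishing
    constant coefficient.\<close>
  moreover have "strict_maps P r 0 = {}" using assms(2) by (auto simp: strict_maps_def PiE_iff)
  ultimately show ?thesis by (cases n) simp_all
qed

section \<open>Maximal chains of sums\<close>

lemma sp_posetD:
  assumes "sp_poset P r"
  shows "finite P" "P \<noteq> {}" "r \<subseteq> P \<times> P" "refl_on P r" "trans r" "antisym r" "finite_poset P r"
  using sp_poset_finite_poset[OF assms] by (auto simp: finite_poset_def order_on_defs)

text \<open>Maximality can be tested one point at a time: a strictly larger chain supplies a new
  point comparable to all of \<open>C\<close>, and adding such a point yields a larger chain.
  Reflexivity absorbs the equality built into \<open>pred_on.chain\<close>.\<close>

lemma maximal_chains_iff:
  assumes "refl_on P r"
  shows "C \<in> maximal_chains P r \<longleftrightarrow>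
    C \<subseteq> P \<and> (\<forall>x\<in>C. \<forall>y\<in>C. (x, y) \<in> r \<or> (y, x) \<in> r) \<and>
    (\<forall>y\<in>P. (\<forall>x\<in>C. (x, y) \<in> r \<or> (y, x) \<in> r) \<longrightarrow> y \<in> C)"
proof -
  let ?R = "\<lambda>x y. (x, y) \<in> r"
  have chain: "pred_on.chain P ?R D \<longleftrightarrow> D \<subseteq> P \<and> (\<forall>x\<in>D. \<forall>y\<in>D. (x, y) \<in> r \<or> (y, x) \<in> r)" for D
    using assms by (auto simp: pred_on.chain_def refl_on_def)
  have "(\<forall>D. pred_on.chain P ?R D \<longrightarrow> \<not> C \<subset> D) \<longleftrightarrow>
      (\<forall>y\<in>P. (\<forall>x\<in>C. (x, y) \<in> r \<or> (y, x) \<in> r) \<longrightarrow> y \<in> C)"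
    if C: "pred_on.chain P ?R C"
  proof
    assume max: "\<forall>D. pred_on.chain P ?R D \<longrightarrow> \<not> C \<subset> D"
    show "\<forall>y\<in>P. (\<forall>x\<in>C. (x, y) \<in> r \<or> (y, x) \<in> r) \<longrightarrow> y \<in> C"
    proof (intro ballI impI)
      fix y assume "y \<in> P" "\<forall>x\<in>C. (x, y) \<in> r \<or> (y, x) \<in> r"
      then have "pred_on.chain P ?R (insert y C)"
        using C assms by (auto simp: chain refl_on_def)
      then show "y \<in> C" using max by blast
    qed
  next
    assume *: "\<forall>y\<in>P. (\<forall>x\<in>C. (x, y) \<in> r \<or> (y, x) \<in> r) \<longrightarrow> y \<in> C"
    show "\<forall>D. pred_on.chain P ?R D \<longrightarrow> \<not> C \<subset> D"
    proof (intro allI impI notI)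
      fix D assume "pred_on.chain P ?R D" "C \<subset> D"
      then show False using * unfolding chain by blast
    qed
  qed
  then show ?thesis
    unfolding maximal_chains_def pred_on.maxchain_def mem_Collect_eq chain by blast
qed

text \<open>In a finite poset a largest chain above \<open>D\<close> exists by finiteness of the
  power set. The result is applied to single points and to comparable pairs, so that facts about
  maximal chains reach all of \<open>P\<close> and all of \<open>r\<close>.\<close>

lemma chain_subset_maximal_chain:
  assumes "finite P" "refl_on P r" "D \<subseteq> P" "\<And>x y. x \<in> D \<Longrightarrow> y \<in> D \<Longrightarrow> (x, y) \<in> r \<or> (y, x) \<in> r"
  shows "\<exists>C\<in>maximal_chains P r. D \<subseteq> C"
proof -
  define F where "F = {C. D \<subseteq> C \<and> C \<subseteq> P \<and> (\<forall>x\<in>C. \<forall>y\<in>C. (x, y) \<in> r \<or> (y, x) \<in> r)}"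
  have "F \<subseteq> Pow P" by (auto simp: F_def)
  then have "finite F" using assms(1) by (meson finite_Pow_iff finite_subset)
  moreover have "D \<in> F" using assms(3,4) by (simp add: F_def)
  ultimately obtain C where C: "C \<in> F" "\<forall>B\<in>F. C \<subseteq> B \<longrightarrow> C = B"
    using finite_has_maximal2[of F D] by blast
  then have ch: "D \<subseteq> C" "C \<subseteq> P" "\<forall>x\<in>C. \<forall>y\<in>C. (x, y) \<in> r \<or> (y, x) \<in> r"
    by (simp_all add: F_def)
  have "y \<in> C" if y: "y \<in> P" "\<forall>x\<in>C. (x, y) \<in> r \<or> (y, x) \<in> r" for y
  proof -
    have "(y, y) \<in> r" using assms(2) y(1) by (simp add: refl_on_def)
    then have "insert y C \<in> F" using ch y unfolding F_def by blast
    then show ?thesis using C(2) by blast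
  qed
  then have "C \<in> maximal_chains P r" unfolding maximal_chains_iff[OF assms(2)] using ch by blast
  then show ?thesis using ch(1) by blast
qed

lemma maximal_chains_nonempty:
  assumes "sp_poset P r" "C \<in> maximal_chains P r"
  shows "C \<noteq> {}" "C \<subseteq> P"
  using assms(2) sp_posetD[OF assms(1)] by (auto simp: maximal_chains_iff)

text \<open>A point comparable to the whole spliced set is comparable to \<open>a\<close>. If it
  lies below \<open>a\<close>, transitivity makes it comparable to the part of \<open>C\<close>
  above \<open>a\<close> as well, so it belongs to the maximal chain \<open>C\<close>; if it lies
  above, it belongs to \<open>D\<close> in the same way.\<close>

lemma splice_maximal_chains:
  assumes "finite_poset P r" "C \<in> maximal_chains P r" "D \<in> maximal_chains P r" "a \<in> C" "a \<in> D"
  shows "{x \<in> C. (x, a) \<in> r} \<union> {x \<in> D. (a, x) \<in> r} \<in> maximal_chains P r"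
proof -
  have refl: "refl_on P r" and tr: "trans r"
    using assms(1) by (auto simp: finite_poset_def order_on_defs)
  let ?E = "{x \<in> C. (x, a) \<in> r} \<union> {x \<in> D. (a, x) \<in> r}"
  have C: "C \<subseteq> P" "\<And>x y. x \<in> C \<Longrightarrow> y \<in> C \<Longrightarrow> (x, y) \<in> r \<or> (y, x) \<in> r"
      "\<And>y. y \<in> P \<Longrightarrow> (\<And>x. x \<in> C \<Longrightarrow> (x, y) \<in> r \<or> (y, x) \<in> r) \<Longrightarrow> y \<in> C"
    using assms(2) unfolding maximal_chains_iff[OF refl] by blast+
  have D: "D \<subseteq> P" "\<And>x y. x \<in> D \<Longrightarrow> y \<in> D \<Longrightarrow> (x, y) \<in> r \<or> (y, x) \<in> r"
      "\<And>y. y \<in> P \<Longrightarrow> (\<And>x. x \<in> D \<Longrightarrow> (x, y) \<in> r \<or> (y, x) \<in> r) \<Longrightarrow> y \<in> D"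
    using assms(3) unfolding maximal_chains_iff[OF refl] by blast+
  have aa: "a \<in> ?E" using assms(4) C refl by (auto simp: refl_on_def)
  have "y \<in> ?E" if y: "y \<in> P" "\<forall>x\<in>?E. (x, y) \<in> r \<or> (y, x) \<in> r" for y
  proof -
    from y(2) aa consider "(y, a) \<in> r" | "(a, y) \<in> r" by blast
    then show ?thesis
    proof cases
      case 1
      have "y \<in> C"
      proof (rule C(3)[OF y(1)])
        fix x assume "x \<in> C"
        then show "(x, y) \<in> r \<or> (y, x) \<in> r"
          using C(2)[of x a] assms(4) y(2) 1 transD[OF tr, of y a x] by blast
      qed
      then show ?thesis using 1 by blast
    next
      case 2
      have "y \<in> D"
      proof (rule D(3)[OF y(1)])
        fix x assume "x \<in> D"
        then show "(x, y) \<in> r \<or> (y, x) \<in> r"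
          using D(2)[of x a] assms(5) y(2) 2 transD[OF tr, of x a y] by blast
      qed
      then show ?thesis using 2 by blast
    qed
  qed
  moreover have "(x, y) \<in> r \<or> (y, x) \<in> r" if "x \<in> ?E" "y \<in> ?E" for x y
    using that C(2)[of x y] D(2)[of x y] transD[OF tr, of x a y] transD[OF tr, of y a x] by blast
  ultimately show ?thesis
    unfolding maximal_chains_iff[OF refl] using C(1) D(1) by blast
qed

text \<open>Two sorted listings of one set have the same head, since each head lies below the other
  and the order is antisymmetric. Exhibiting one listing therefore evaluates
  \<open>chain_list\<close>.\<close>

lemma chain_list_eqI:
  assumes "finite_poset P r" "C \<in> maximal_chains P r"
    and "distinct xs" "set xs = C" "sorted_wrt (\<lambda>x y. (x, y) \<in> r) xs"
  shows "chain_list r C = xs"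
proof -
  have "antisym r" using assms(1) by (auto simp: finite_poset_def order_on_defs)
  have "ys = xs"
    if "distinct xs" "distinct ys" "set ys = set xs"
      "sorted_wrt (\<lambda>x y. (x, y) \<in> r) xs" "sorted_wrt (\<lambda>x y. (x, y) \<in> r) ys" for xs ys
    using that
  proof (induction xs arbitrary: ys)
    case (Cons x xs)
    then obtain y ys' where ys: "ys = y # ys'" by (cases ys) auto
    have "x = y"
    proof (rule ccontr)
      assume "x \<noteq> y"
      then have "y \<in> set xs" "x \<in> set ys'" using Cons.prems ys by auto
      then show False
        using Cons.prems ys \<open>x \<noteq> y\<close> antisymD[OF \<open>antisym r\<close>, of x y] by auto
    qed
    moreover have "set ys' = set xs" using Cons.prems ys \<open>x = y\<close> by (auto simp: set_eq_iff)
    ultimately show ?case using Cons ys by auto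
  qed simp
  then show ?thesis using chain_list[OF assms(1,2)] assms by metis
qed

text \<open>Any point \<open>c\<close> of \<open>C\<close> is incomparable to every point of
  \<open>Q\<close>, so no point of \<open>Q\<close> can extend \<open>C\<close>. Nonemptiness of
  \<open>C\<close> supplies this \<open>c\<close>.\<close>

lemma maximal_chains_Un_subset:
  assumes "refl_on P r" "refl_on (P \<union> Q) (r \<union> s)" "r \<subseteq> P \<times> P" "s \<subseteq> Q \<times> Q" "P \<inter> Q = {}"
    and "C \<subseteq> P" "C \<noteq> {}"
  shows "C \<in> maximal_chains (P \<union> Q) (r \<union> s) \<longleftrightarrow> C \<in> maximal_chains P r"
proof -
  obtain c where c: "c \<in> C" "c \<in> P" using assms(6,7) by blast
  have same: "(x, y) \<in> r \<union> s \<or> (y, x) \<in> r \<union> s \<longleftrightarrow> (x, y) \<in> r \<or> (y, x) \<in> r"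
    if "x \<in> C" "y \<in> P" for x y
    using that assms(4,5,6) by blast
  have same_ball: "(\<forall>x\<in>C. (x, y) \<in> r \<union> s \<or> (y, x) \<in> r \<union> s) \<longleftrightarrow> (\<forall>x\<in>C. (x, y) \<in> r \<or> (y, x) \<in> r)"
    if "y \<in> P" for y
    by (intro ball_cong refl same that)
  have incomparable: "(c, y) \<notin> r \<union> s" "(y, c) \<notin> r \<union> s" if "y \<in> Q" for y
    using that c assms(3-5) by blast+
  have "(\<forall>y\<in>P \<union> Q. (\<forall>x\<in>C. (x, y) \<in> r \<union> s \<or> (y, x) \<in> r \<union> s) \<longrightarrow> y \<in> C) \<longleftrightarrow>
      (\<forall>y\<in>P. (\<forall>x\<in>C. (x, y) \<in> r \<union> s \<or> (y, x) \<in> r \<union> s) \<longrightarrow> y \<in> C)"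
    using incomparable c(1) by blast
  also have "\<dots> \<longleftrightarrow> (\<forall>y\<in>P. (\<forall>x\<in>C. (x, y) \<in> r \<or> (y, x) \<in> r) \<longrightarrow> y \<in> C)"
    by (intro ball_cong refl) (simp only: same_ball)
  finally have "(\<forall>y\<in>P \<union> Q. (\<forall>x\<in>C. (x, y) \<in> r \<union> s \<or> (y, x) \<in> r \<union> s) \<longrightarrow> y \<in> C) \<longleftrightarrow> \<dots>" .
  moreover have "(\<forall>x\<in>C. \<forall>y\<in>C. (x, y) \<in> r \<union> s \<or> (y, x) \<in> r \<union> s) \<longleftrightarrow>
      (\<forall>x\<in>C. \<forall>y\<in>C. (x, y) \<in> r \<or> (y, x) \<in> r)"
    using assms(6) by (intro ball_cong refl same) blast+
  ultimately show ?thesis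
    unfolding maximal_chains_iff[OF assms(1)] maximal_chains_iff[OF assms(2)] using assms(6) by blast
qed

section \<open>Disjoint unions and ordinal sums of SP-posets\<close>

context
  fixes P Q :: "'a set" and r s :: "'a rel"
  assumes P: "sp_poset P r" and Q: "sp_poset Q s" and disj: "P \<inter> Q = {}"
begin

text \<open>Points of different summands are incomparable, so a chain stays in one summand; being
  nonempty, it is maximal there exactly if it is maximal in the union.\<close>

lemma maximal_chains_disjoint_union:
  "maximal_chains (P \<union> Q) (r \<union> s) = maximal_chains P r \<union> maximal_chains Q s"
proof -
  note P' = sp_posetD[OF P] and Q' = sp_posetD[OF Q]
  note PQ = sp_poset.disjoint_union[OF P Q disj]
  have in_P: "C \<in> maximal_chains (P \<union> Q) (r \<union> s) \<longleftrightarrow> C \<in> maximal_chains P r"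
    if "C \<subseteq> P" "C \<noteq> {}" for C
    using maximal_chains_Un_subset[OF P'(4) sp_posetD(4)[OF PQ] P'(3) Q'(3) disj that] .
  have in_Q: "C \<in> maximal_chains (P \<union> Q) (r \<union> s) \<longleftrightarrow> C \<in> maximal_chains Q s"
    if "C \<subseteq> Q" "C \<noteq> {}" for C
    using maximal_chains_Un_subset[of Q s P r C] Q'(4) sp_posetD(4)[OF PQ] P'(3) Q'(3) disj that
    by (simp add: Un_commute Int_commute)
  have "C \<subseteq> P \<or> C \<subseteq> Q" if C: "C \<in> maximal_chains (P \<union> Q) (r \<union> s)" for C
  proof (rule ccontr)
    assume "\<not> (C \<subseteq> P \<or> C \<subseteq> Q)"
    moreover have "C \<subseteq> P \<union> Q" using maximal_chains_nonempty(2)[OF PQ C] .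
    ultimately obtain x y where xy: "x \<in> C" "x \<in> P" "y \<in> C" "y \<in> Q" by blast
    then have "(x, y) \<in> r \<union> s \<or> (y, x) \<in> r \<union> s"
      using C unfolding maximal_chains_iff[OF sp_posetD(4)[OF PQ]] by blast
    then show False using xy P'(3) Q'(3) disj by blast
  qed
  then show ?thesis
    using in_P in_Q maximal_chains_nonempty[OF P] maximal_chains_nonempty[OF Q]
      maximal_chains_nonempty[OF PQ] by (intro equalityI subsetI) (metis Un_iff)+
qed

lemma chain_list_disjoint_union:
  "M \<in> maximal_chains P r \<Longrightarrow> chain_list (r \<union> s) M = chain_list r M"
  "N \<in> maximal_chains Q s \<Longrightarrow> chain_list (r \<union> s) N = chain_list s N"
proof -
  note U = chain_list_eqI[OF sp_posetD(7)[OF sp_poset.disjoint_union[OF P Q disj]]]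
  show "chain_list (r \<union> s) M = chain_list r M" if M: "M \<in> maximal_chains P r"
  proof (rule U)
    show "sorted_wrt (\<lambda>x y. (x, y) \<in> r \<union> s) (chain_list r M)"
      by (rule sorted_wrt_mono_rel[OF _ chain_list(3)[OF sp_posetD(7)[OF P] M]]) simp
  qed (use chain_list[OF sp_posetD(7)[OF P] M] M maximal_chains_disjoint_union in auto)
  show "chain_list (r \<union> s) N = chain_list s N" if N: "N \<in> maximal_chains Q s"
  proof (rule U)
    show "sorted_wrt (\<lambda>x y. (x, y) \<in> r \<union> s) (chain_list s N)"
      by (rule sorted_wrt_mono_rel[OF _ chain_list(3)[OF sp_posetD(7)[OF Q] N]]) simp
  qed (use chain_list[OF sp_posetD(7)[OF Q] N] N maximal_chains_disjoint_union in auto)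
qed

lemma card_extremal_points_disjoint_union:
  "card (minimal_points (P \<union> Q) (r \<union> s)) = card (minimal_points P r) + card (minimal_points Q s)"
  "card (maximal_points (P \<union> Q) (r \<union> s)) = card (maximal_points P r) + card (maximal_points Q s)"
proof -
  note P' = sp_posetD[OF P] and Q' = sp_posetD[OF Q]
  have sub: "minimal_points P r \<subseteq> P" "minimal_points Q s \<subseteq> Q"
      "maximal_points P r \<subseteq> P" "maximal_points Q s \<subseteq> Q"
    by (auto simp: minimal_points_def maximal_points_def)
  have "minimal_points (P \<union> Q) (r \<union> s) = minimal_points P r \<union> minimal_points Q s"
      "maximal_points (P \<union> Q) (r \<union> s) = maximal_points P r \<union> maximal_points Q s"
    using P'(3) Q'(3) disj by (auto simp: minimal_points_def maximal_points_def)
  then show "card (minimal_points (P \<union> Q) (r \<union> s)) = card (minimal_points P r) + card (minimal_points Q s)"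
    "card (maximal_points (P \<union> Q) (r \<union> s)) = card (maximal_points P r) + card (maximal_points Q s)"
    using sub P'(1) Q'(1) disj by (auto intro!: card_Un_disjoint dest: finite_subset)
qed

text \<open>Points of different summands are always comparable, so both the chain condition and the
  maximality condition for \<open>M \<union> N\<close> split into one condition on \<open>M\<close>
  and one on \<open>N\<close>. Intersecting with \<open>P\<close> and \<open>Q\<close> inverts the
  union.\<close>

lemma bij_betw_maximal_chains_ordinal_sum:
  "bij_betw (\<lambda>(M, N). M \<union> N) (maximal_chains P r \<times> maximal_chains Q s)
     (maximal_chains (P \<union> Q) (r \<union> s \<union> P \<times> Q))"
proof -
  note P' = sp_posetD[OF P] and Q' = sp_posetD[OF Q]
    and PQ = sp_posetD[OF sp_poset.ordinal_sum[OF P Q disj]]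
  let ?t = "r \<union> s \<union> P \<times> Q"
  have cmp: "(x, y) \<in> ?t \<or> (y, x) \<in> ?t \<longleftrightarrow> (x, y) \<in> r \<or> (y, x) \<in> r" if "x \<in> P" "y \<in> P" for x y
    using that Q'(3) disj by blast
  have cmp': "(x, y) \<in> ?t \<or> (y, x) \<in> ?t \<longleftrightarrow> (x, y) \<in> s \<or> (y, x) \<in> s" if "x \<in> Q" "y \<in> Q" for x y
    using that P'(3) disj by blast
  have Un: "M \<union> N \<in> maximal_chains (P \<union> Q) (r \<union> s \<union> P \<times> Q) \<longleftrightarrow>
      M \<in> maximal_chains P r \<and> N \<in> maximal_chains Q s"
    if sub: "M \<subseteq> P" "N \<subseteq> Q" for M N
  proof -
    have "(\<forall>x\<in>M \<union> N. \<forall>y\<in>M \<union> N. (x, y) \<in> ?t \<or> (y, x) \<in> ?t) \<longleftrightarrow>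
        (\<forall>x\<in>M. \<forall>y\<in>M. (x, y) \<in> ?t \<or> (y, x) \<in> ?t) \<and> (\<forall>x\<in>N. \<forall>y\<in>N. (x, y) \<in> ?t \<or> (y, x) \<in> ?t)"
      using sub by blast
    also have "\<dots> \<longleftrightarrow> (\<forall>x\<in>M. \<forall>y\<in>M. (x, y) \<in> r \<or> (y, x) \<in> r) \<and>
        (\<forall>x\<in>N. \<forall>y\<in>N. (x, y) \<in> s \<or> (y, x) \<in> s)"
      by (intro arg_cong2[where f = conj] ball_cong refl cmp cmp') (use sub in blast)+
    finally have 1: "(\<forall>x\<in>M \<union> N. \<forall>y\<in>M \<union> N. (x, y) \<in> ?t \<or> (y, x) \<in> ?t) \<longleftrightarrow> \<dots>" .
    have "(\<forall>x\<in>M \<union> N. (x, y) \<in> ?t \<or> (y, x) \<in> ?t) \<longleftrightarrow> (\<forall>x\<in>M. (x, y) \<in> r \<or> (y, x) \<in> r)"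
      if "y \<in> P" for y
    proof -
      have "(\<forall>x\<in>M \<union> N. (x, y) \<in> ?t \<or> (y, x) \<in> ?t) \<longleftrightarrow> (\<forall>x\<in>M. (x, y) \<in> ?t \<or> (y, x) \<in> ?t)"
        using that sub by blast
      also have "\<dots> \<longleftrightarrow> (\<forall>x\<in>M. (x, y) \<in> r \<or> (y, x) \<in> r)"
        by (intro ball_cong refl cmp) (use that sub in blast)+
      finally show ?thesis .
    qed
    moreover have "(\<forall>x\<in>M \<union> N. (x, y) \<in> ?t \<or> (y, x) \<in> ?t) \<longleftrightarrow> (\<forall>x\<in>N. (x, y) \<in> s \<or> (y, x) \<in> s)"
      if "y \<in> Q" for y
    proof -
      have "(\<forall>x\<in>M \<union> N. (x, y) \<in> ?t \<or> (y, x) \<in> ?t) \<longleftrightarrow> (\<forall>x\<in>N. (x, y) \<in> ?t \<or> (y, x) \<in> ?t)"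
        using that sub by blast
      also have "\<dots> \<longleftrightarrow> (\<forall>x\<in>N. (x, y) \<in> s \<or> (y, x) \<in> s)"
        by (intro ball_cong refl cmp') (use that sub in blast)+
      finally show ?thesis .
    qed
    moreover have "y \<in> M \<union> N \<longleftrightarrow> y \<in> M" if "y \<in> P" for y using that sub disj by blast
    moreover have "y \<in> M \<union> N \<longleftrightarrow> y \<in> N" if "y \<in> Q" for y using that sub disj by blast
    ultimately have 2: "(\<forall>y\<in>P \<union> Q. (\<forall>x\<in>M \<union> N. (x, y) \<in> ?t \<or> (y, x) \<in> ?t) \<longrightarrow> y \<in> M \<union> N) \<longleftrightarrow>
        (\<forall>y\<in>P. (\<forall>x\<in>M. (x, y) \<in> r \<or> (y, x) \<in> r) \<longrightarrow> y \<in> M) \<and>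
        (\<forall>y\<in>Q. (\<forall>x\<in>N. (x, y) \<in> s \<or> (y, x) \<in> s) \<longrightarrow> y \<in> N)"
      unfolding ball_Un by simp
    show ?thesis
      unfolding maximal_chains_iff[OF P'(4)] maximal_chains_iff[OF Q'(4)]
        maximal_chains_iff[OF PQ(4)] 1 2 using sub by blast
  qed
  show ?thesis
  proof (rule bij_betw_byWitness[where f' = "\<lambda>C. (C \<inter> P, C \<inter> Q)"])
    show "\<forall>a\<in>maximal_chains P r \<times> maximal_chains Q s.
        (\<lambda>C. (C \<inter> P, C \<inter> Q)) (case a of (M, N) \<Rightarrow> M \<union> N) = a"
      using maximal_chains_nonempty(2)[OF P] maximal_chains_nonempty(2)[OF Q] disj by fastforce
    have C: "C \<inter> P \<union> C \<inter> Q = C" if "C \<in> maximal_chains (P \<union> Q) (r \<union> s \<union> P \<times> Q)" for C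
      using maximal_chains_nonempty(2)[OF sp_poset.ordinal_sum[OF P Q disj] that] by blast
    then show "\<forall>C\<in>maximal_chains (P \<union> Q) (r \<union> s \<union> P \<times> Q).
        (case (C \<inter> P, C \<inter> Q) of (M, N) \<Rightarrow> M \<union> N) = C"
      by simp
    show "(\<lambda>(M, N). M \<union> N) ` (maximal_chains P r \<times> maximal_chains Q s)
        \<subseteq> maximal_chains (P \<union> Q) (r \<union> s \<union> P \<times> Q)"
      using Un maximal_chains_nonempty(2)[OF P] maximal_chains_nonempty(2)[OF Q] by auto
    show "(\<lambda>C. (C \<inter> P, C \<inter> Q)) ` maximal_chains (P \<union> Q) (r \<union> s \<union> P \<times> Q)
        \<subseteq> maximal_chains P r \<times> maximal_chains Q s"
    proof (intro image_subsetI)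
      fix C assume "C \<in> maximal_chains (P \<union> Q) (r \<union> s \<union> P \<times> Q)"
      then have "C \<inter> P \<union> C \<inter> Q \<in> maximal_chains (P \<union> Q) (r \<union> s \<union> P \<times> Q)" by (simp add: C)
      then show "(C \<inter> P, C \<inter> Q) \<in> maximal_chains P r \<times> maximal_chains Q s"
        using Un[of "C \<inter> P" "C \<inter> Q"] by blast
    qed
  qed
qed

lemma chain_list_ordinal_sum:
  assumes M: "M \<in> maximal_chains P r" and N: "N \<in> maximal_chains Q s"
  shows "chain_list (r \<union> s \<union> P \<times> Q) (M \<union> N) = chain_list r M @ chain_list s N"
proof (rule chain_list_eqI[OF sp_posetD(7)[OF sp_poset.ordinal_sum[OF P Q disj]]])
  show "M \<union> N \<in> maximal_chains (P \<union> Q) (r \<union> s \<union> P \<times> Q)"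
    using bij_betw_maximal_chains_ordinal_sum M N by (auto simp: bij_betw_def)
  note ch = chain_list[OF sp_posetD(7)[OF P] M] chain_list[OF sp_posetD(7)[OF Q] N]
  have sub: "M \<subseteq> P" "N \<subseteq> Q"
    using maximal_chains_nonempty[OF P M] maximal_chains_nonempty[OF Q N] by auto
  then show "distinct (chain_list r M @ chain_list s N)" using ch disj by auto
  show "set (chain_list r M @ chain_list s N) = M \<union> N" using ch by simp
  show "sorted_wrt (\<lambda>x y. (x, y) \<in> r \<union> s \<union> P \<times> Q) (chain_list r M @ chain_list s N)"
    unfolding sorted_wrt_append
  proof (intro conjI ballI)
    show "sorted_wrt (\<lambda>x y. (x, y) \<in> r \<union> s \<union> P \<times> Q) (chain_list r M)"
      by (rule sorted_wrt_mono_rel[OF _ ch(3)]) simp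
    show "sorted_wrt (\<lambda>x y. (x, y) \<in> r \<union> s \<union> P \<times> Q) (chain_list s N)"
      by (rule sorted_wrt_mono_rel[OF _ ch(6)]) simp
    show "(x, y) \<in> r \<union> s \<union> P \<times> Q" if "x \<in> set (chain_list r M)" "y \<in> set (chain_list s N)" for x y
      using that sub ch by blast
  qed
qed

lemma extremal_points_ordinal_sum:
  "minimal_points (P \<union> Q) (r \<union> s \<union> P \<times> Q) = minimal_points P r"
  "maximal_points (P \<union> Q) (r \<union> s \<union> P \<times> Q) = maximal_points Q s"
proof -
  note P' = sp_posetD[OF P] and Q' = sp_posetD[OF Q]
  show "minimal_points (P \<union> Q) (r \<union> s \<union> P \<times> Q) = minimal_points P r"
    using P'(2,3) Q'(3) disj unfolding minimal_points_def by blast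
  show "maximal_points (P \<union> Q) (r \<union> s \<union> P \<times> Q) = maximal_points Q s"
    using Q'(2,3) P'(3) disj unfolding maximal_points_def by blast
qed

end

section \<open>Labelled posets with prescribed label sequences\<close>

lemma maximal_chains_point: "maximal_chains {a} {(a, a)} = {{a}}"
  by (auto simp: maximal_chains_iff[of "{a}"] refl_on_def)

lemma extremal_points_point:
  "minimal_points {a} {(a, a)} = {a}" "maximal_points {a} {(a, a)} = {a}"
  by (auto simp: minimal_points_def maximal_points_def)

lemma chain_list_point: "chain_list {(a, a)} {a} = [a]"
  using sp_posetD(7)[OF sp_poset.point]
  by (rule chain_list_eqI) (auto simp: maximal_chains_point)

section \<open>Sums of labelled posets\<close>

definition labelled_sum :: "'a labelled_poset \<Rightarrow> 'a labelled_poset \<Rightarrow> 'a labelled_poset" where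
  "labelled_sum S T = (points S \<union> points T, order_rel S \<union> order_rel T,
     \<lambda>x. if x \<in> points S then label S x else label T x)"

definition labelled_ordinal_sum :: "'a labelled_poset \<Rightarrow> 'a labelled_poset \<Rightarrow> 'a labelled_poset" where
  "labelled_ordinal_sum S T =
     (points S \<union> points T, order_rel S \<union> order_rel T \<union> points S \<times> points T,
      \<lambda>x. if x \<in> points S then label S x else label T x)"

context
  fixes S T :: "'a labelled_poset"
  assumes S: "sp_poset (points S) (order_rel S)" and T: "sp_poset (points T) (order_rel T)"
    and disj: "points S \<inter> points T = {}"
begin

text \<open>Both sums label points in the same way, so one argument serves them. Disjoint carriers
  ensure that a point of \<open>T\<close> never falls into the branch for \<open>S\<close>.\<close>

lemma chain_labels_Un:
  assumes "U = labelled_sum S T \<or> U = labelled_ordinal_sum S T"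
  shows "M \<in> chains_of S \<Longrightarrow> map (label U) (chain_list (order_rel S) M) = label_seq S M"
    and "N \<in> chains_of T \<Longrightarrow> map (label U) (chain_list (order_rel T) N) = label_seq T N"
proof -
  have lab: "label U = (\<lambda>x. if x \<in> points S then label S x else label T x)"
    using assms by (auto simp: labelled_sum_def labelled_ordinal_sum_def)
  show "map (label U) (chain_list (order_rel S) M) = label_seq S M" if M: "M \<in> chains_of S"
    using chain_list(2)[OF sp_posetD(7)[OF S]] maximal_chains_nonempty(2)[OF S] M
    by (auto simp: label_seq_def chains_of_def lab)
  show "map (label U) (chain_list (order_rel T) N) = label_seq T N" if N: "N \<in> chains_of T"
  proof -
    have N': "N \<in> maximal_chains (points T) (order_rel T)" using N by (simp add: chains_of_def)
    have "x \<notin> points S" if "x \<in> N" for x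
      using maximal_chains_nonempty(2)[OF T N'] that disj by blast
    then show ?thesis
      using chain_list(2)[OF sp_posetD(7)[OF T] N'] by (simp add: label_seq_def lab)
  qed
qed

lemma sp_poset_labelled_sum:
  "sp_poset (points (labelled_sum S T)) (order_rel (labelled_sum S T))"
  using sp_poset.disjoint_union[OF S T disj] by (simp add: labelled_sum_def)

lemma chains_of_labelled_sum: "chains_of (labelled_sum S T) = chains_of S \<union> chains_of T"
  using maximal_chains_disjoint_union[OF S T disj] by (simp add: labelled_sum_def chains_of_def)

lemma label_seq_labelled_sum:
  "M \<in> chains_of S \<Longrightarrow> label_seq (labelled_sum S T) M = label_seq S M"
  "N \<in> chains_of T \<Longrightarrow> label_seq (labelled_sum S T) N = label_seq T N"
proof -
  have ord: "order_rel (labelled_sum S T) = order_rel S \<union> order_rel T"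
    by (simp add: labelled_sum_def)
  show "label_seq (labelled_sum S T) M = label_seq S M" if "M \<in> chains_of S"
    using chain_list_disjoint_union(1)[OF S T disj, of M] chain_labels_Un(1)[of "labelled_sum S T" M] that
    by (simp add: label_seq_def chains_of_def ord)
  show "label_seq (labelled_sum S T) N = label_seq T N" if "N \<in> chains_of T"
    using chain_list_disjoint_union(2)[OF S T disj, of N] chain_labels_Un(2)[of "labelled_sum S T" N] that
    by (simp add: label_seq_def chains_of_def ord)
qed

lemma sp_poset_labelled_ordinal_sum:
  "sp_poset (points (labelled_ordinal_sum S T)) (order_rel (labelled_ordinal_sum S T))"
  using sp_poset.ordinal_sum[OF S T disj] by (simp add: labelled_ordinal_sum_def)

lemma bij_betw_chains_of_labelled_ordinal_sum:
  "bij_betw (\<lambda>(M, N). M \<union> N) (chains_of S \<times> chains_of T) (chains_of (labelled_ordinal_sum S T))"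
  using bij_betw_maximal_chains_ordinal_sum[OF S T disj]
  by (simp add: labelled_ordinal_sum_def chains_of_def)

lemma label_seq_labelled_ordinal_sum:
  assumes "M \<in> chains_of S" "N \<in> chains_of T"
  shows "label_seq (labelled_ordinal_sum S T) (M \<union> N) = label_seq S M @ label_seq T N"
proof -
  have "order_rel (labelled_ordinal_sum S T) = order_rel S \<union> order_rel T \<union> points S \<times> points T"
    by (simp add: labelled_ordinal_sum_def)
  then have "label_seq (labelled_ordinal_sum S T) (M \<union> N) =
      map (label (labelled_ordinal_sum S T)) (chain_list (order_rel S) M @ chain_list (order_rel T) N)"
    using chain_list_ordinal_sum[OF S T disj, of M N] assms
    by (simp add: label_seq_def chains_of_def)
  then show ?thesis
    using chain_labels_Un[of "labelled_ordinal_sum S T"] assms by simp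
qed

end

text \<open>One fresh point is placed below a chain for the tail of the word. Taking points from an
  arbitrary infinite set \<open>X\<close> allows carriers of different pieces to be chosen
  disjoint.\<close>

lemma exists_labelled_chain:
  assumes "ws \<noteq> []" "infinite X"
  shows "\<exists>S. points S \<subseteq> X \<and> sp_poset (points S) (order_rel S) \<and> chains_of S = {points S} \<and>
    label_seq S (points S) = ws \<and> card (minimal_points (points S) (order_rel S)) = 1 \<and>
    card (maximal_points (points S) (order_rel S)) = 1"
  using assms
proof (induction ws arbitrary: X rule: list_nonempty_induct)
  case (single u)
  then obtain z where "z \<in> X" using infinite_imp_nonempty by blast
  then show ?case
    by (intro exI[of _ "({z}, {(z, z)}, \<lambda>_. u)"])
      (simp add: sp_poset.point chains_of_def maximal_chains_point label_seq_def chain_list_point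
        extremal_points_point)
next
  case (cons u us)
  from cons.prems obtain z where "z \<in> X" using infinite_imp_nonempty by blast
  have "infinite (X - {z})" using cons.prems by simp
  from cons.IH[OF this] obtain T where T: "points T \<subseteq> X - {z}" "sp_poset (points T) (order_rel T)"
    "chains_of T = {points T}" "label_seq T (points T) = us"
    "card (minimal_points (points T) (order_rel T)) = 1"
    "card (maximal_points (points T) (order_rel T)) = 1"
    by (elim exE conjE)
  define S :: "'a labelled_poset" where "S = ({z}, {(z, z)}, \<lambda>_. u)"
  have S: "sp_poset (points S) (order_rel S)" "points S = {z}" "chains_of S = {{z}}"
    "label_seq S {z} = [u]"
    by (simp_all add: S_def sp_poset.point chains_of_def maximal_chains_point label_seq_def chain_list_point)
  have disj: "points S \<inter> points T = {}" using T(1) S(2) by auto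
  let ?U = "labelled_ordinal_sum S T"
  have pts: "points ?U = insert z (points T)" by (simp add: labelled_ordinal_sum_def S(2))
  have "chains_of ?U = {points ?U}"
    using bij_betw_imp_surj_on[OF bij_betw_chains_of_labelled_ordinal_sum[OF S(1) T(2) disj]]
    by (simp add: S(3) T(3) pts)
  moreover have "label_seq ?U (points ?U) = u # us"
    using label_seq_labelled_ordinal_sum[OF S(1) T(2) disj, of "{z}" "points T"]
    by (simp add: S(3,4) T(3,4) pts)
  moreover have "card (minimal_points (points ?U) (order_rel ?U)) = 1"
    "card (maximal_points (points ?U) (order_rel ?U)) = 1"
    using extremal_points_ordinal_sum[OF S(1) T(2) disj] T(6)
    by (simp_all add: labelled_ordinal_sum_def S_def extremal_points_point)
  ultimately show ?case
    using sp_poset_labelled_ordinal_sum[OF S(1) T(2) disj] T(1) \<open>z \<in> X\<close> pts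
    by (intro exI[of _ ?U]) auto
qed

section \<open>Realizing prescribed words along the construction of an SP-poset\<close>

text \<open>The conditions on a colimit-indexing shuffle, relaxed for induction: the word of each
  chain is prescribed by \<open>w\<close>, and the chain labels come from any set \<open>K\<close>,
  so that pieces using different label ranges can be assembled. Requiring \<open>sp_poset\<close>
  makes the results on sums applicable to the labelled poset too.\<close>

definition realizes ::
    "'a set \<Rightarrow> 'a rel \<Rightarrow> nat set \<Rightarrow> ('a list \<Rightarrow> ('a + nat) list) \<Rightarrow> 'a labelled_poset \<Rightarrow> bool" where
  "realizes P r K w S \<longleftrightarrow>
     sp_poset (points S) (order_rel S) \<and> label S ` points S \<subseteq> P <+> K \<and>
     card (minimal_points (points S) (order_rel S)) = card (minimal_points P r) \<and>
     card (maximal_points (points S) (order_rel S)) = card (maximal_points P r) \<and>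
     (\<forall>p\<in>P. \<exists>!a. a \<in> points S \<and> label S a = Inl p) \<and>
     (\<exists>\<phi>. bij_betw \<phi> (maximal_chains P r) (chains_of S) \<and>
          (\<forall>M\<in>maximal_chains P r. label_seq S (\<phi> M) = w (chain_list r M)))"

text \<open>The one-point poset has a single maximal chain, so a labelled chain carrying
  \<open>w [p]\<close> suffices; distinct entries make the point labelled \<open>p\<close>
  unique.\<close>

lemma realizes_point:
  assumes "distinct (w [p])" "set (w [p]) \<subseteq> {p} <+> K" "Inl p \<in> set (w [p])" "infinite X"
  shows "\<exists>S. points S \<subseteq> X \<and> realizes {p} {(p, p)} K w S"
proof -
  have "w [p] \<noteq> []" using assms(3) by auto
  from exists_labelled_chain[OF this assms(4)] obtain S where
    S: "points S \<subseteq> X" "sp_poset (points S) (order_rel S)" "chains_of S = {points S}"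
    "label_seq S (points S) = w [p]" "card (minimal_points (points S) (order_rel S)) = 1"
    "card (maximal_points (points S) (order_rel S)) = 1"
    by auto
  have set: "set (chain_list (order_rel S) (points S)) = points S"
    using chain_list(2)[OF sp_posetD(7)[OF S(2)]] S(3) by (auto simp: chains_of_def)
  have labels: "label S ` points S = set (w [p])"
    using S(4) set by (metis label_seq_def list.set_map)
  have inj: "inj_on (label S) (points S)"
    using S(4) set assms(1) by (metis label_seq_def distinct_map)
  have "Inl p \<in> label S ` points S" using labels assms(3) by simp
  then obtain a where a: "Inl p = label S a" "a \<in> points S" by (rule imageE)
  have "\<exists>!a. a \<in> points S \<and> label S a = Inl p"
  proof (rule ex1I[of _ a])
    fix b assume "b \<in> points S \<and> label S b = Inl p"
    then show "b = a" using a by (intro inj_onD[OF inj]) simp_all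
  qed (simp add: a)
  moreover have "bij_betw (\<lambda>_. points S) {{p}} {points S}" by (simp add: bij_betw_def)
  ultimately have "realizes {p} {(p, p)} K w S"
    unfolding realizes_def maximal_chains_point S(3) using S(2,4,5,6) labels assms(2)
    by (auto simp: extremal_points_point chain_list_point)
  then show ?thesis using S(1) by blast
qed

lemma realizes_disjoint_union:
  assumes P: "sp_poset P r" and Q: "sp_poset Q s" and PQ: "P \<inter> Q = {}"
    and S: "realizes P r K w S" and T: "realizes Q s K w T" and ST: "points S \<inter> points T = {}"
  shows "realizes (P \<union> Q) (r \<union> s) K w (labelled_sum S T)"
proof -
  let ?U = "labelled_sum S T"
  have spS: "sp_poset (points S) (order_rel S)" and spT: "sp_poset (points T) (order_rel T)"
    using S T by (simp_all add: realizes_def)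
  have labS: "label S ` points S \<subseteq> P <+> K" and labT: "label T ` points T \<subseteq> Q <+> K"
    using S T by (simp_all add: realizes_def)
  have U: "points ?U = points S \<union> points T" "order_rel ?U = order_rel S \<union> order_rel T"
    by (simp_all add: labelled_sum_def)
  have lab: "label ?U x = label S x" if "x \<in> points S" for x
    using that by (simp add: labelled_sum_def)
  have lab': "label ?U x = label T x" if "x \<in> points T" for x
    using that ST by (auto simp: labelled_sum_def)
  have "label ?U ` points ?U \<subseteq> (P \<union> Q) <+> K"
    unfolding U image_Un using labS labT by (auto simp: lab lab')
  moreover have "\<exists>!a. a \<in> points ?U \<and> label ?U a = Inl p" if "p \<in> P \<union> Q" for p
  proof (cases "p \<in> P")
    case True
    then have "\<exists>!a. a \<in> points S \<and> label S a = Inl p" using S by (simp add: realizes_def)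
    moreover have "label T a \<noteq> Inl p" if "a \<in> points T" for a
      using labT that True PQ by fastforce
    ultimately show ?thesis unfolding U using lab lab' by (metis Un_iff)
  next
    case False
    then have "\<exists>!a. a \<in> points T \<and> label T a = Inl p" using T that by (simp add: realizes_def)
    moreover have "label S a \<noteq> Inl p" if "a \<in> points S" for a
      using labS that False by fastforce
    ultimately show ?thesis unfolding U using lab lab' by (metis Un_iff)
  qed
  moreover have "\<exists>\<phi>. bij_betw \<phi> (maximal_chains (P \<union> Q) (r \<union> s)) (chains_of ?U) \<and>
      (\<forall>M\<in>maximal_chains (P \<union> Q) (r \<union> s). label_seq ?U (\<phi> M) = w (chain_list (r \<union> s) M))"
  proof -
    obtain \<phi> where \<phi>: "bij_betw \<phi> (maximal_chains P r) (chains_of S)"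
      "\<And>M. M \<in> maximal_chains P r \<Longrightarrow> label_seq S (\<phi> M) = w (chain_list r M)"
      using S unfolding realizes_def by blast
    obtain \<psi> where \<psi>: "bij_betw \<psi> (maximal_chains Q s) (chains_of T)"
      "\<And>M. M \<in> maximal_chains Q s \<Longrightarrow> label_seq T (\<psi> M) = w (chain_list s M)"
      using T unfolding realizes_def by blast
    \<comment> \<open>The two chain bijections are glued by cases. Chains of \<open>P\<close> and of
      \<open>Q\<close> are nonempty subsets of disjoint sets, so the cases do not overlap, and
      likewise for the chains of \<open>S\<close> and \<open>T\<close>.\<close>
    define \<chi> where "\<chi> M = (if M \<in> maximal_chains P r then \<phi> M else \<psi> M)" for M
    have notP: "N \<notin> maximal_chains P r" if "N \<in> maximal_chains Q s" for N
      using maximal_chains_nonempty[OF P, of N] maximal_chains_nonempty[OF Q that] PQ by blast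
    have "chains_of S \<inter> chains_of T = {}"
      using maximal_chains_nonempty[OF spS] maximal_chains_nonempty[OF spT] ST
      unfolding chains_of_def by blast
    moreover have "bij_betw \<chi> (maximal_chains P r) (chains_of S)"
      using \<phi>(1) by (simp add: \<chi>_def cong: bij_betw_cong)
    moreover have "bij_betw \<chi> (maximal_chains Q s) (chains_of T)"
      using \<psi>(1) notP by (simp add: \<chi>_def cong: bij_betw_cong)
    ultimately have "bij_betw \<chi> (maximal_chains (P \<union> Q) (r \<union> s)) (chains_of ?U)"
      unfolding maximal_chains_disjoint_union[OF P Q PQ] chains_of_labelled_sum[OF spS spT ST]
      by (intro bij_betw_combine)
    moreover have "label_seq ?U (\<chi> M) = w (chain_list (r \<union> s) M)"
      if "M \<in> maximal_chains P r" for M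
      using that \<phi> label_seq_labelled_sum(1)[OF spS spT ST, of "\<phi> M"] bij_betwE[OF \<phi>(1)]
      by (simp add: \<chi>_def chain_list_disjoint_union[OF P Q PQ])
    moreover have "label_seq ?U (\<chi> M) = w (chain_list (r \<union> s) M)"
      if "M \<in> maximal_chains Q s" for M
      using that \<psi> label_seq_labelled_sum(2)[OF spS spT ST, of "\<psi> M"] bij_betwE[OF \<psi>(1)] notP
      by (simp add: \<chi>_def chain_list_disjoint_union[OF P Q PQ])
    ultimately show ?thesis
      unfolding maximal_chains_disjoint_union[OF P Q PQ] by blast
  qed
  moreover have "sp_poset (points ?U) (order_rel ?U)"
    using sp_poset_labelled_sum[OF spS spT ST] .
  moreover have "card (minimal_points (points ?U) (order_rel ?U)) = card (minimal_points (P \<union> Q) (r \<union> s))"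
    "card (maximal_points (points ?U) (order_rel ?U)) = card (maximal_points (P \<union> Q) (r \<union> s))"
    using S T unfolding U card_extremal_points_disjoint_union[OF spS spT ST]
      card_extremal_points_disjoint_union[OF P Q PQ] by (simp_all add: realizes_def)
  ultimately show ?thesis unfolding realizes_def by blast
qed

text \<open>The point \<open>z\<close> lies above all of \<open>S\<close> and below all of
  \<open>T\<close>, so every maximal chain passes through it and shows \<open>Inr k\<close> between
  the two words. The hypothesis on \<open>u\<close> asks for exactly this factorization.\<close>

lemma realizes_ordinal_sum:
  assumes P: "sp_poset P r" and Q: "sp_poset Q s" and PQ: "P \<inter> Q = {}"
    and S: "realizes P r K v S" and T: "realizes Q s L w T" and ST: "points S \<inter> points T = {}"
    and z: "z \<notin> points S \<union> points T"
    and u: "\<And>M N. M \<in> maximal_chains P r \<Longrightarrow> N \<in> maximal_chains Q s \<Longrightarrow>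
      u (chain_list r M @ chain_list s N) = v (chain_list r M) @ Inr k # w (chain_list s N)"
  shows "realizes (P \<union> Q) (r \<union> s \<union> P \<times> Q) (K \<union> {k} \<union> L) u
    (labelled_ordinal_sum S (labelled_ordinal_sum ({z}, {(z, z)}, \<lambda>_. Inr k) T))"
proof -
  define Z :: "'a labelled_poset" where "Z = ({z}, {(z, z)}, \<lambda>_. Inr k)"
  define Y where "Y = labelled_ordinal_sum Z T"
  define U where "U = labelled_ordinal_sum S Y"
  have spS: "sp_poset (points S) (order_rel S)" and spT: "sp_poset (points T) (order_rel T)"
    using S T by (simp_all add: realizes_def)
  have labS: "label S ` points S \<subseteq> P <+> K" and labT: "label T ` points T \<subseteq> Q <+> L"
    using S T by (simp_all add: realizes_def)
  have Z: "sp_poset (points Z) (order_rel Z)" "points Z = {z}" "chains_of Z = {{z}}"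
    "label_seq Z {z} = [Inr k]"
    by (simp_all add: Z_def sp_poset.point chains_of_def maximal_chains_point label_seq_def chain_list_point)
  have ZT: "points Z \<inter> points T = {}" using z Z(2) by auto
  have spY: "sp_poset (points Y) (order_rel Y)"
    unfolding Y_def by (rule sp_poset_labelled_ordinal_sum[OF Z(1) spT ZT])
  have SY: "points S \<inter> points Y = {}"
    using ST z by (auto simp: Y_def labelled_ordinal_sum_def Z(2))
  have spU: "sp_poset (points U) (order_rel U)"
    unfolding U_def by (rule sp_poset_labelled_ordinal_sum[OF spS spY SY])
  have U: "points U = points S \<union> {z} \<union> points T"
    by (simp add: U_def Y_def labelled_ordinal_sum_def Z(2) Un_assoc)
  have lab: "label U x = label S x" if "x \<in> points S" for x
    using that by (simp add: U_def labelled_ordinal_sum_def)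
  have lab': "label U x = label T x" if "x \<in> points T" for x
    using that ST z by (auto simp: U_def Y_def Z_def labelled_ordinal_sum_def)
  have labz: "label U z = Inr k"
    using z by (simp add: U_def Y_def Z_def labelled_ordinal_sum_def)
  have "label U ` points U \<subseteq> (P \<union> Q) <+> (K \<union> {k} \<union> L)"
    unfolding U image_Un using labS labT by (auto simp: lab lab' labz)
  moreover have "\<exists>!a. a \<in> points U \<and> label U a = Inl p" if "p \<in> P \<union> Q" for p
  proof (cases "p \<in> P")
    case True
    then have "\<exists>!a. a \<in> points S \<and> label S a = Inl p" using S by (simp add: realizes_def)
    moreover have "label T a \<noteq> Inl p" if "a \<in> points T" for a
      using labT that True PQ by fastforce
    ultimately show ?thesis unfolding U using lab lab' labz by (metis Inl_Inr_False Un_iff singletonD)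
  next
    case False
    then have "\<exists>!a. a \<in> points T \<and> label T a = Inl p" using T that by (simp add: realizes_def)
    moreover have "label S a \<noteq> Inl p" if "a \<in> points S" for a
      using labS that False by fastforce
    ultimately show ?thesis unfolding U using lab lab' labz by (metis Inl_Inr_False Un_iff singletonD)
  qed
  moreover have "\<exists>\<chi>. bij_betw \<chi> (maximal_chains (P \<union> Q) (r \<union> s \<union> P \<times> Q)) (chains_of U) \<and>
      (\<forall>M\<in>maximal_chains (P \<union> Q) (r \<union> s \<union> P \<times> Q). label_seq U (\<chi> M) = u (chain_list (r \<union> s \<union> P \<times> Q) M))"
  proof -
    obtain \<phi> where \<phi>: "bij_betw \<phi> (maximal_chains P r) (chains_of S)"
      "\<And>M. M \<in> maximal_chains P r \<Longrightarrow> label_seq S (\<phi> M) = v (chain_list r M)"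
      using S unfolding realizes_def by blast
    obtain \<psi> where \<psi>: "bij_betw \<psi> (maximal_chains Q s) (chains_of T)"
      "\<And>M. M \<in> maximal_chains Q s \<Longrightarrow> label_seq T (\<psi> M) = w (chain_list s M)"
      using T unfolding realizes_def by blast
    let ?h = "\<lambda>(M, N). M \<union> N"
    let ?A = "maximal_chains P r \<times> maximal_chains Q s"
    note h = bij_betw_maximal_chains_ordinal_sum[OF P Q PQ]
    note hY = bij_betw_chains_of_labelled_ordinal_sum[OF Z(1) spT ZT, folded Y_def]
    \<comment> \<open>Since \<open>{z}\<close> is the only chain of \<open>Z\<close>, the pairs of
      chains reduce to chains of \<open>T\<close> with \<open>z\<close> added at the bottom.\<close>
    have "bij_betw (\<lambda>N. {z} \<union> N) (chains_of T) (chains_of Y)"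
      using hY by (auto simp: bij_betw_def Z(3) inj_on_def image_def)
    then have "bij_betw (map_prod \<phi> ((\<lambda>N. {z} \<union> N) \<circ> \<psi>)) ?A (chains_of S \<times> chains_of Y)"
      by (intro bij_betw_map_prod \<phi>(1) bij_betw_trans[OF \<psi>(1)])
    from bij_betw_trans[OF this bij_betw_chains_of_labelled_ordinal_sum[OF spS spY SY, folded U_def]]
    have g: "bij_betw (?h \<circ> map_prod \<phi> ((\<lambda>N. {z} \<union> N) \<circ> \<psi>)) ?A (chains_of U)" .
    \<comment> \<open>A maximal chain of the ordinal sum is split into its two parts, these are
      transported separately, and the results are joined through \<open>z\<close>.\<close>
    define \<chi> where "\<chi> = ?h \<circ> map_prod \<phi> ((\<lambda>N. {z} \<union> N) \<circ> \<psi>) \<circ> inv_into ?A ?h"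
    have "bij_betw \<chi> (maximal_chains (P \<union> Q) (r \<union> s \<union> P \<times> Q)) (chains_of U)"
      unfolding \<chi>_def by (rule bij_betw_trans[OF bij_betw_inv_into[OF h] g])
    moreover have "label_seq U (\<chi> C) = u (chain_list (r \<union> s \<union> P \<times> Q) C)"
      if C: "C \<in> maximal_chains (P \<union> Q) (r \<union> s \<union> P \<times> Q)" for C
    proof -
      obtain M N where MN: "M \<in> maximal_chains P r" "N \<in> maximal_chains Q s" "C = M \<union> N"
        using C unfolding bij_betw_imp_surj_on[OF h, symmetric] by auto
      have "inv_into ?A ?h C = (M, N)"
        using inv_into_f_f[OF bij_betw_imp_inj_on[OF h], of "(M, N)"] MN by simp
      then have \<chi>: "\<chi> C = \<phi> M \<union> ({z} \<union> \<psi> N)" by (simp add: \<chi>_def)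
      have mem: "\<phi> M \<in> chains_of S" "\<psi> N \<in> chains_of T"
        using bij_betwE[OF \<phi>(1)] bij_betwE[OF \<psi>(1)] MN by auto
      have "{z} \<union> \<psi> N \<in> chains_of Y"
        using bij_betwE[OF hY, rule_format, of "({z}, \<psi> N)"] mem by (simp add: Z(3))
      then have "label_seq U (\<chi> C) = label_seq S (\<phi> M) @ label_seq Y ({z} \<union> \<psi> N)"
        unfolding \<chi> using label_seq_labelled_ordinal_sum[OF spS spY SY mem(1)] by (simp only: U_def)
      also have "label_seq Y ({z} \<union> \<psi> N) = Inr k # label_seq T (\<psi> N)"
        using label_seq_labelled_ordinal_sum[OF Z(1) spT ZT, of "{z}" "\<psi> N"] mem
        by (simp add: Y_def Z(3,4))
      also have "label_seq S (\<phi> M) @ Inr k # label_seq T (\<psi> N) = u (chain_list r M @ chain_list s N)"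
        using \<phi>(2) \<psi>(2) MN u by simp
      also have "\<dots> = u (chain_list (r \<union> s \<union> P \<times> Q) C)"
        using chain_list_ordinal_sum[OF P Q PQ MN(1,2)] MN(3) by simp
      finally show ?thesis .
    qed
    ultimately show ?thesis by blast
  qed
  moreover have "card (minimal_points (points U) (order_rel U)) = card (minimal_points (P \<union> Q) (r \<union> s \<union> P \<times> Q))"
  proof -
    have "minimal_points (points U) (order_rel U) = minimal_points (points S) (order_rel S)"
      using extremal_points_ordinal_sum(1)[OF spS spY SY] by (simp add: U_def labelled_ordinal_sum_def)
    then show ?thesis
      using S extremal_points_ordinal_sum(1)[OF P Q PQ] by (simp add: realizes_def)
  qed
  moreover have "card (maximal_points (points U) (order_rel U)) = card (maximal_points (P \<union> Q) (r \<union> s \<union> P \<times> Q))"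
  proof -
    have "maximal_points (points U) (order_rel U) = maximal_points (points Y) (order_rel Y)"
      using extremal_points_ordinal_sum(2)[OF spS spY SY] by (simp add: U_def labelled_ordinal_sum_def)
    also have "\<dots> = maximal_points (points T) (order_rel T)"
      using extremal_points_ordinal_sum(2)[OF Z(1) spT ZT] by (simp add: Y_def labelled_ordinal_sum_def)
    finally show ?thesis
      using T extremal_points_ordinal_sum(2)[OF P Q PQ] by (simp add: realizes_def)
  qed
  ultimately show ?thesis
    unfolding realizes_def Z_def[symmetric] Y_def[symmetric] U_def[symmetric] using spU by blast
qed

text \<open>The induction keeps \<open>a\<close>, \<open>b\<close> and \<open>X\<close> free: a
  disjoint union hands the same interval to both summands, whereas an ordinal sum cuts it at
  \<open>c\<close>. The infinite set \<open>X\<close> is a supply of points that can be divided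
  between the summands.\<close>

lemma exists_realization:
  assumes "sp_poset P r"
    and "\<And>x y. x \<in> P \<Longrightarrow> y \<in> P \<Longrightarrow> (x, y) \<in> r \<Longrightarrow> x \<noteq> y \<Longrightarrow> f x < f y"
    and "\<And>x. x \<in> P \<Longrightarrow> a \<le> f x \<and> f x \<le> b" "infinite X"
  shows "\<exists>S. points S \<subseteq> X \<and> realizes P r {Suc a..b} (deck_word f a b) S"
  using assms
proof (induction arbitrary: a b X rule: sp_poset.induct)
  case (point p)
  have p: "a \<le> f p" "f p \<le> b" using point.prems(2)[of p] by auto
  show ?case
  proof (rule realizes_point[OF _ _ _ point.prems(3)])
    show "distinct (deck_word f a b [p])" by (auto simp: distinct_map simp del: upt_Suc)
    show "set (deck_word f a b [p]) \<subseteq> {p} <+> {Suc a..b}" using p by auto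
    show "Inl p \<in> set (deck_word f a b [p])" by simp
  qed
next
  case (disjoint_union P r Q s)
  obtain Y Z where YZ: "Y \<subseteq> X" "Z \<subseteq> X" "infinite Y" "infinite Z" "Y \<inter> Z = {}"
    using infinite_split[OF disjoint_union.prems(3)] .
  have "\<exists>S. points S \<subseteq> Y \<and> realizes P r {Suc a..b} (deck_word f a b) S"
    by (rule disjoint_union.IH(1)) (simp_all add: disjoint_union.prems YZ)
  then obtain S where S: "points S \<subseteq> Y" "realizes P r {Suc a..b} (deck_word f a b) S" by blast
  have "\<exists>T. points T \<subseteq> Z \<and> realizes Q s {Suc a..b} (deck_word f a b) T"
    by (rule disjoint_union.IH(2)) (simp_all add: disjoint_union.prems YZ)
  then obtain T where T: "points T \<subseteq> Z" "realizes Q s {Suc a..b} (deck_word f a b) T" by blast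
  have "points S \<inter> points T = {}" using S(1) T(1) YZ(5) by blast
  from realizes_disjoint_union[OF disjoint_union.hyps(1,2,3) S(2) T(2) this]
  have "realizes (P \<union> Q) (r \<union> s) {Suc a..b} (deck_word f a b) (labelled_sum S T)" .
  moreover have "points (labelled_sum S T) \<subseteq> X"
    using S(1) T(1) YZ by (auto simp: labelled_sum_def)
  ultimately show ?case by blast
next
  case (ordinal_sum P r Q s)
  note P = sp_posetD[OF ordinal_sum.hyps(1)] and Q = sp_posetD[OF ordinal_sum.hyps(2)]
  define c where "c = Max (f ` P)"
  obtain q where q: "q \<in> Q" using Q(2) by blast
  \<comment> \<open>The maximum is attained at some \<open>p\<close>, which lies below every point
    of \<open>Q\<close>; strictness of \<open>f\<close> then gives \<open>c < f y\<close> throughout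
    \<open>Q\<close>.\<close>
  have "c \<in> f ` P" unfolding c_def by (rule Max_in) (simp_all add: P(1,2))
  then obtain p where p: "p \<in> P" "f p = c" by blast
  have fP: "f x \<le> c" if "x \<in> P" for x using that P(1) by (simp add: c_def)
  have fQ: "c < f y" if "y \<in> Q" for y
    using ordinal_sum.prems(1)[of p y] that p ordinal_sum.hyps(3) by blast
  have ac: "a \<le> c" using ordinal_sum.prems(2)[of p] p by simp
  have cb: "c < b" using ordinal_sum.prems(2)[of q] fQ[OF q] q by simp
  obtain Y Z where YZ: "Y \<subseteq> X" "Z \<subseteq> X" "infinite Y" "infinite Z" "Y \<inter> Z = {}"
    using infinite_split[OF ordinal_sum.prems(3)] .
  obtain z where z: "z \<in> Z" using YZ(4) infinite_imp_nonempty by blast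
  have "\<exists>S. points S \<subseteq> Y \<and> realizes P r {Suc a..c} (deck_word f a c) S"
    by (rule ordinal_sum.IH(1)) (simp_all add: ordinal_sum.prems YZ fP)
  then obtain S where S: "points S \<subseteq> Y" "realizes P r {Suc a..c} (deck_word f a c) S" by blast
  \<comment> \<open>Label \<open>Suc c\<close> is spent on \<open>z\<close>, so the upper summand
    starts after it; the required lower bound \<open>Suc c \<le> f y\<close> is just
    \<open>c < f y\<close>. Removing \<open>z\<close> from the supply keeps it fresh.\<close>
  have "\<exists>T. points T \<subseteq> Z - {z} \<and> realizes Q s {Suc (Suc c)..b} (deck_word f (Suc c) b) T"
    by (rule ordinal_sum.IH(2)) (simp_all add: ordinal_sum.prems YZ fQ Suc_le_eq)
  then obtain T where T: "points T \<subseteq> Z - {z}"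
    "realizes Q s {Suc (Suc c)..b} (deck_word f (Suc c) b) T" by blast
  let ?U = "labelled_ordinal_sum S (labelled_ordinal_sum ({z}, {(z, z)}, \<lambda>_. Inr (Suc c)) T)"
  have "realizes (P \<union> Q) (r \<union> s \<union> P \<times> Q) ({Suc a..c} \<union> {Suc c} \<union> {Suc (Suc c)..b})
      (deck_word f a b) ?U"
  proof (rule realizes_ordinal_sum[OF ordinal_sum.hyps(1,2,3) S(2) T(2)])
    show "points S \<inter> points T = {}" using S(1) T(1) YZ(5) by blast
    show "z \<notin> points S \<union> points T" using S(1) T(1) YZ(5) z by blast
    fix M N assume MN: "M \<in> maximal_chains P r" "N \<in> maximal_chains Q s"
    then have "set (chain_list r M) \<subseteq> P" "set (chain_list s N) \<subseteq> Q"
      using chain_list(2)[OF P(7) MN(1)] chain_list(2)[OF Q(7) MN(2)]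
        maximal_chains_nonempty(2)[OF ordinal_sum.hyps(1) MN(1)]
        maximal_chains_nonempty(2)[OF ordinal_sum.hyps(2) MN(2)] by simp_all
    then show "deck_word f a b (chain_list r M @ chain_list s N) =
        deck_word f a c (chain_list r M) @ Inr (Suc c) # deck_word f (Suc c) b (chain_list s N)"
      using fP fQ by (intro deck_word_append[OF ac cb]) blast+
  qed
  moreover have "{Suc a..c} \<union> {Suc c} \<union> {Suc (Suc c)..b} = {Suc a..b}" using ac cb by auto
  moreover have "points ?U \<subseteq> X" using S(1) T(1) YZ z by (auto simp: labelled_ordinal_sum_def)
  ultimately show ?case by metis
qed

section \<open>Shuffles and strict maps\<close>

text \<open>A relation rather than a function, because \<open>f\<close> prescribes only the label
  sequences and hence fixes \<open>S\<close> merely up to identification.\<close>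

definition encodes :: "'a set \<Rightarrow> 'a rel \<Rightarrow> nat \<Rightarrow> 'a labelled_poset \<Rightarrow> ('a \<Rightarrow> nat) \<Rightarrow> bool" where
  "encodes P r n S f \<longleftrightarrow> (\<exists>\<phi>. chain_bijection P r n S \<phi> \<and>
     (\<forall>M\<in>maximal_chains P r. label_seq S (\<phi> M) = deck_word f 0 n (chain_list r M)))"

lemma sorted_wrt_chain_list:
  assumes "finite_poset P r" "M \<in> maximal_chains P r" "M \<subseteq> P"
    and "\<And>x y. x \<in> P \<Longrightarrow> y \<in> P \<Longrightarrow> (x, y) \<in> r \<Longrightarrow> x \<noteq> y \<Longrightarrow> f x < (f y :: nat)"
  shows "sorted_wrt (\<lambda>x y. f x < f y) (chain_list r M)"
proof -
  note ch = chain_list[OF assms(1,2)]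
  show ?thesis
    unfolding sorted_wrt_iff_nth_less
  proof (intro allI impI)
    fix i j assume ij: "i < j" "j < length (chain_list r M)"
    then have "chain_list r M ! i \<in> P" "chain_list r M ! j \<in> P"
      using ch(2) assms(3) nth_mem[of i "chain_list r M"] nth_mem[of j "chain_list r M"] by auto
    moreover have "chain_list r M ! i \<noteq> chain_list r M ! j"
      using ij ch(1) by (simp add: nth_eq_iff_index_eq)
    moreover have "(chain_list r M ! i, chain_list r M ! j) \<in> r"
      using ij ch(3) by (simp add: sorted_wrt_iff_nth_less)
    ultimately show "f (chain_list r M ! i) < f (chain_list r M ! j)" using assms(4) by blast
  qed
qed

section \<open>From strict maps to shuffles\<close>

lemma exists_ldd_shuffle_encoding:
  assumes P: "sp_poset P r" and f: "f \<in> strict_maps P r (n - 1)"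
  shows "\<exists>S\<in>ldd_shuffles P r n. encodes P r n S f"
proof -
  note P' = sp_posetD[OF P]
  have strict: "f x < f y" if "x \<in> P" "y \<in> P" "(x, y) \<in> r" "x \<noteq> y" for x y
    using f that by (simp add: strict_maps_def)
  have range: "0 < f x" "f x < n" if "x \<in> P" for x
  proof -
    have "f x \<in> {1..n - 1}" using f that by (auto simp: strict_maps_def PiE_iff)
    then show "0 < f x" "f x < n" by auto
  qed
  have "\<exists>S. points S \<subseteq> UNIV \<and> realizes P r {Suc 0..n} (deck_word f 0 n) S"
    by (rule exists_realization[OF P strict]) (use range in \<open>auto intro: less_imp_le\<close>)
  then obtain S where S: "realizes P r {Suc 0..n} (deck_word f 0 n) S" by blast
  then obtain \<phi> where \<phi>: "bij_betw \<phi> (maximal_chains P r) (chains_of S)"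
    "\<And>M. M \<in> maximal_chains P r \<Longrightarrow> label_seq S (\<phi> M) = deck_word f 0 n (chain_list r M)"
    unfolding realizes_def by blast
  have xs: "set (chain_list r M) \<subseteq> P" "chain_list r M \<noteq> []"
    "sorted_wrt (\<lambda>x y. f x < f y) (chain_list r M)" if M: "M \<in> maximal_chains P r" for M
    using chain_list(2)[OF P'(7) M] maximal_chains_nonempty[OF P M]
      sorted_wrt_chain_list[OF P'(7) M _ strict] by auto
  have "chain_bijection P r n S \<phi>"
    unfolding chain_bijection_def
  proof (intro conjI ballI \<phi>(1))
    fix M assume M: "M \<in> maximal_chains P r"
    have "deck_word f 0 n (chain_list r M)
        \<in> shuffles (map Inl (chain_list r M)) (map Inr [Suc 0..<Suc n])"
    proof (rule deck_word_in_shuffles)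
      show "sorted_wrt (\<lambda>x y. f x \<le> f y) (chain_list r M)"
        by (rule sorted_wrt_mono_rel[OF _ xs(3)[OF M]]) simp
    qed (use xs(1)[OF M] range in \<open>auto intro: less_imp_le\<close>)
    then show "label_seq S (\<phi> M) \<in> shuffles (map Inl (chain_list r M)) (map Inr [1..<Suc n])"
      using \<phi>(2)[OF M] by simp
  qed
  then have "encodes P r n S f" using \<phi>(2) unfolding encodes_def by blast
  moreover have "colimit_shuffle P r n S"
    using S \<open>chain_bijection P r n S \<phi>\<close> sp_posetD(7)[of "points S" "order_rel S"]
    unfolding colimit_shuffle_def realizes_def One_nat_def by blast
  moreover have "label_seq S m \<noteq> [] \<and> \<not> isl (hd (label_seq S m)) \<and> \<not> isl (last (label_seq S m)) \<and>
      successively (\<lambda>a b. \<not> (isl a \<and> isl b)) (label_seq S m)" if m: "m \<in> chains_of S" for m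
  proof -
    \<comment> \<open>Every maximal chain of \<open>S\<close> is some \<open>\<phi> M\<close>, so
      the deck-divider conditions need checking only on deck words.\<close>
    obtain M where M: "M \<in> maximal_chains P r" "m = \<phi> M"
      using m bij_betw_imp_surj_on[OF \<phi>(1)] by blast
    note xsM = xs[OF M(1)]
    have "hd (chain_list r M) \<in> P" "last (chain_list r M) \<in> P"
      using xsM(1,2) hd_in_set last_in_set by blast+
    then have "0 < f (hd (chain_list r M))" "f (last (chain_list r M)) < n" by (simp_all add: range)
    moreover have "successively (\<lambda>x y. f x < f y) (chain_list r M)"
      using xsM(3) by (rule successively_if_sorted_wrt)
    ultimately show ?thesis
      using xsM(2) unfolding M(2) \<phi>(2)[OF M(1)] successively_deck_word
      by (simp add: isl_hd_deck_word isl_last_deck_word deck_word_nonempty)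
  qed
  ultimately show ?thesis unfolding ldd_shuffles_def by blast
qed

section \<open>From shuffles to strict maps\<close>

text \<open>In the sorted listing, the points before \<open>a\<close> are exactly those of
  \<open>C\<close> strictly below it. Turning the position into a cardinality lets chains be cut at
  \<open>a\<close> and compared as sets.\<close>

lemma deck_position_chain_list:
  assumes "finite_poset A s" "C \<in> maximal_chains A s" "a \<in> C" "l a = Inl p"
    and "\<And>x. x \<in> C \<Longrightarrow> l x = Inl p \<Longrightarrow> x = a"
  shows "deck_position (map l (chain_list s C)) p =
    card {x \<in> C. (x, a) \<in> s \<and> x \<noteq> a \<and> \<not> isl (l x)}"
proof -
  have "antisym s" using assms(1) by (auto simp: finite_poset_def order_on_defs)
  note ch = chain_list[OF assms(1,2)]
  obtain us vs where cs: "chain_list s C = us @ a # vs"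
    using assms(3) ch(2) split_list by metis
  have sub: "set us \<subseteq> C" "set vs \<subseteq> C" "a \<notin> set us" "a \<notin> set vs" "distinct us"
    using ch(1,2) cs by auto
  have before: "(x, a) \<in> s" if "x \<in> set us" for x
    using ch(3) that by (simp add: cs sorted_wrt_append)
  have after: "(a, x) \<in> s" if "x \<in> set vs" for x
    using ch(3) that by (simp add: cs sorted_wrt_append)
  have us: "set us = {x \<in> C. (x, a) \<in> s \<and> x \<noteq> a}"
  proof (intro equalityI subsetI)
    fix x assume "x \<in> set us"
    then show "x \<in> {x \<in> C. (x, a) \<in> s \<and> x \<noteq> a}" using before sub by blast
  next
    fix x assume x: "x \<in> {x \<in> C. (x, a) \<in> s \<and> x \<noteq> a}"
    then have "x \<notin> set vs" using after antisymD[OF \<open>antisym s\<close>, of x a] by blast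
    moreover have "x \<in> set (us @ a # vs)" using x ch(2) cs by simp
    ultimately show "x \<in> set us" using x by simp
  qed
  have "l x \<noteq> Inl p" if "x \<in> set us" for x using assms(5)[of x] that sub by blast
  then have "takeWhile (\<lambda>u. u \<noteq> Inl p) (map l (chain_list s C)) = map l us"
    by (simp add: cs takeWhile_append assms(4))
  then have "deck_position (map l (chain_list s C)) p = length (filter (\<lambda>x. \<not> isl (l x)) us)"
    by (simp add: deck_position_def filter_map comp_def)
  also have "\<dots> = card {x \<in> set us. \<not> isl (l x)}"
    using distinct_card[of "filter (\<lambda>x. \<not> isl (l x)) us"] sub(5) by simp
  finally show ?thesis unfolding us by simp
qed

text \<open>
  The position of \<open>p\<close> in a label sequence does not depend on the chain: cutting two maximal chains
  at the point labelled \<open>p\<close> and exchanging their upper parts gives maximal chains again, and all of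
  them carry exactly \<open>n\<close> labels from the chain.
\<close>

lemma deck_position_unique:
  assumes S: "colimit_shuffle P r n S" and P: "finite_poset P r"
    and \<phi>: "chain_bijection P r n S \<phi>"
    and M: "M \<in> maximal_chains P r" "p \<in> M" and N: "N \<in> maximal_chains P r" "p \<in> N"
    and p: "p \<in> P"
  shows "deck_position (label_seq S (\<phi> M)) p = deck_position (label_seq S (\<phi> N)) p"
proof -
  let ?A = "points S" and ?s = "order_rel S" and ?l = "label S"
  have A: "finite_poset ?A ?s" using S by (simp add: colimit_shuffle_def)
  then have refl: "refl_on ?A ?s" and anti: "antisym ?s" and finA: "finite ?A"
    by (auto simp: finite_poset_def order_on_defs)
  obtain a where a: "a \<in> ?A" "?l a = Inl p" and uniq: "\<And>x. x \<in> ?A \<Longrightarrow> ?l x = Inl p \<Longrightarrow> x = a"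
    using S p unfolding colimit_shuffle_def by blast
  have chain: "\<phi> L \<in> maximal_chains ?A ?s" if "L \<in> maximal_chains P r" for L
    using \<phi> that unfolding chain_bijection_def chains_of_def by (blast dest: bij_betwE)
  have chain_sub: "C \<subseteq> ?A" if "C \<in> maximal_chains ?A ?s" for C
    using that unfolding maximal_chains_iff[OF refl] by blast
  have shuffle: "label_seq S (\<phi> L) \<in> shuffles (map Inl (chain_list r L)) (map Inr [1..<Suc n])"
    if "L \<in> maximal_chains P r" for L
    using \<phi> that unfolding chain_bijection_def by blast
  \<comment> \<open>Only one point of the shuffle carries the label \<open>Inl p\<close>, so all
    chains belonging to some \<open>L\<close> through \<open>p\<close> meet in the same point
    \<open>a\<close>.\<close>
  have mem: "a \<in> \<phi> L" if L: "L \<in> maximal_chains P r" "p \<in> L" for L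
  proof -
    have "Inl p \<in> set (label_seq S (\<phi> L))"
      using set_shuffles[OF shuffle[OF L(1)]] L(2) chain_list(2)[OF P L(1)] by simp
    then obtain x where x: "x \<in> \<phi> L" "?l x = Inl p"
      using chain_list(2)[OF A chain[OF L(1)]] by (auto simp: label_seq_def)
    then show ?thesis using uniq[of x] chain_sub[OF chain[OF L(1)]] by blast
  qed
  \<comment> \<open>Filtering an interleaving down to its chain labels returns the list from
    \<open>1\<close> to \<open>n\<close>, whichever chain of \<open>P\<close> it comes from.\<close>
  have total: "card {x \<in> C. \<not> isl (?l x)} = n" if C: "C \<in> maximal_chains ?A ?s" for C
  proof -
    obtain L where L: "L \<in> maximal_chains P r" "C = \<phi> L"
      using C \<phi> unfolding chain_bijection_def chains_of_def bij_betw_def by blast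
    have "filter (\<lambda>u. \<not> isl u) (label_seq S C) \<in> (filter (\<lambda>u. \<not> isl u)) `
        shuffles (map Inl (chain_list r L)) (map Inr [1..<Suc n])"
      using shuffle[OF L(1)] L(2) by blast
    also have "\<dots> = {map Inr [1..<Suc n]}"
      unfolding filter_shuffles by (simp add: filter_map comp_def del: upt_Suc)
    finally have "length (filter (\<lambda>u. \<not> isl u) (label_seq S C)) = n" by (simp del: upt_Suc)
    then have "length (filter (\<lambda>x. \<not> isl (?l x)) (chain_list ?s C)) = n"
      by (simp add: label_seq_def filter_map comp_def)
    then show ?thesis
      using distinct_card[of "filter (\<lambda>x. \<not> isl (?l x)) (chain_list ?s C)"] chain_list[OF A C] by simp
  qed
  define lower where "lower C = {x \<in> C. (x, a) \<in> ?s \<and> x \<noteq> a \<and> \<not> isl (?l x)}" for C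
  define upper where "upper C = {x \<in> C. (a, x) \<in> ?s \<and> x \<noteq> a \<and> \<not> isl (?l x)}" for C
  have count: "card (lower C) + card (upper D) = n"
    if C: "C \<in> maximal_chains ?A ?s" "a \<in> C" and D: "D \<in> maximal_chains ?A ?s" "a \<in> D" for C D
  proof -
    have "{x \<in> {x \<in> C. (x, a) \<in> ?s} \<union> {x \<in> D. (a, x) \<in> ?s}. \<not> isl (?l x)} = lower C \<union> upper D"
      using a(2) by (auto simp: lower_def upper_def)
    then have "card (lower C \<union> upper D) = n"
      using total[OF splice_maximal_chains[OF A C(1) D(1) C(2) D(2)]] by simp
    moreover have "finite (lower C)" "finite (upper D)"
      using finite_subset[OF chain_sub[OF C(1)] finA] finite_subset[OF chain_sub[OF D(1)] finA]
      by (simp_all add: lower_def upper_def)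
    moreover have "lower C \<inter> upper D = {}"
      using antisymD[OF anti] by (auto simp: lower_def upper_def)
    ultimately show ?thesis by (simp add: card_Un_disjoint)
  qed
  have "deck_position (label_seq S (\<phi> L)) p = card (lower (\<phi> L))"
    if L: "L \<in> maximal_chains P r" "p \<in> L" for L
    unfolding label_seq_def lower_def
    using chain_sub[OF chain[OF L(1)]]
    by (intro deck_position_chain_list[OF A chain[OF L(1)] mem[OF L]] a(2) uniq) blast+
  \<comment> \<open>Both lower parts are completed to \<open>n\<close> by the same upper part of
    \<open>\<phi> N\<close>, once by splicing and once within \<open>\<phi> N\<close>
    itself.\<close>
  moreover have "card (lower (\<phi> M)) = card (lower (\<phi> N))"
    using count[OF chain[OF M(1)] mem[OF M] chain[OF N(1)] mem[OF N]]
      count[OF chain[OF N(1)] mem[OF N] chain[OF N(1)] mem[OF N]] by simp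
  ultimately show ?thesis using M N by simp
qed

text \<open>Each label sequence is the deck word of its own positions. By
  \<open>deck_position_unique\<close> these positions agree wherever chains overlap and so form a
  single map on \<open>P\<close>.\<close>

lemma ldd_shuffle_encodes:
  assumes P: "sp_poset P r" and S: "S \<in> ldd_shuffles P r n"
  shows "\<exists>f\<in>strict_maps P r (n - 1). encodes P r n S f"
proof -
  note P' = sp_posetD[OF P]
  have colim: "colimit_shuffle P r n S" using S by (simp add: ldd_shuffles_def)
  then obtain \<phi> where \<phi>: "chain_bijection P r n S \<phi>" unfolding colimit_shuffle_def by blast
  \<comment> \<open>Any maximal chain through \<open>p\<close> serves to read off the value; the
    default \<open>undefined\<close> outside \<open>P\<close> makes \<open>f\<close>
    extensional.\<close>
  define f where "f p = (if p \<in> P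
      then deck_position (label_seq S (\<phi> (SOME M. M \<in> maximal_chains P r \<and> p \<in> M))) p
      else undefined)" for p
  have f: "f p = deck_position (label_seq S (\<phi> M)) p" if M: "M \<in> maximal_chains P r" "p \<in> M" for M p
  proof -
    have p: "p \<in> P" using maximal_chains_nonempty(2)[OF P M(1)] M(2) by blast
    have "(SOME M. M \<in> maximal_chains P r \<and> p \<in> M) \<in> maximal_chains P r \<and>
        p \<in> (SOME M. M \<in> maximal_chains P r \<and> p \<in> M)"
      using M by (intro someI[of "\<lambda>M. M \<in> maximal_chains P r \<and> p \<in> M" M]) simp
    then show ?thesis
      using deck_position_unique[OF colim P'(7) \<phi> _ _ M p] p by (simp add: f_def)
  qed
  have word: "label_seq S (\<phi> M) = deck_word f 0 n (chain_list r M)"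
    if M: "M \<in> maximal_chains P r" for M
  proof -
    have "label_seq S (\<phi> M) \<in> shuffles (map Inl (chain_list r M)) (map Inr [Suc 0..<Suc n])"
      using \<phi> M unfolding chain_bijection_def One_nat_def by blast
    from shuffles_eq_deck_word[OF this chain_list(1)[OF P'(7) M]]
    have "label_seq S (\<phi> M) =
        deck_word (\<lambda>x. deck_position (label_seq S (\<phi> M)) x) 0 n (chain_list r M)"
      by simp
    also have "\<dots> = deck_word f 0 n (chain_list r M)"
      using f[OF M] chain_list(2)[OF P'(7) M] by (intro deck_word_cong) simp
    finally show ?thesis .
  qed
  have sorted: "sorted_wrt (\<lambda>x y. f x < f y) (chain_list r M)"
    and hd: "0 < f (hd (chain_list r M))" and last: "f (last (chain_list r M)) < n"
    and nonempty: "chain_list r M \<noteq> []"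
    if M: "M \<in> maximal_chains P r" for M
  proof -
    show ne: "chain_list r M \<noteq> []"
      using chain_list(2)[OF P'(7) M] maximal_chains_nonempty(1)[OF P M] by auto
    have "\<phi> M \<in> chains_of S" using \<phi> M unfolding chain_bijection_def by (blast dest: bij_betwE)
    then have "\<not> isl (hd (label_seq S (\<phi> M)))" "\<not> isl (last (label_seq S (\<phi> M)))"
      "successively (\<lambda>a b. \<not> (isl a \<and> isl b)) (label_seq S (\<phi> M))"
      using S unfolding ldd_shuffles_def by blast+
    then have "0 < f (hd (chain_list r M))" "f (last (chain_list r M)) < n"
      "successively (\<lambda>x y. f x < f y) (chain_list r M)"
      unfolding word[OF M] successively_deck_word using ne
      by (simp_all add: isl_hd_deck_word isl_last_deck_word)
    \<comment> \<open>The deck-divider condition compares only neighbouring points; transitivity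
      extends the inequality to all pairs on the chain.\<close>
    moreover have "transp (\<lambda>x y. f x < f y)" by (auto intro: transpI)
    ultimately show "sorted_wrt (\<lambda>x y. f x < f y) (chain_list r M)"
      "0 < f (hd (chain_list r M))" "f (last (chain_list r M)) < n"
      by (simp_all add: successively_conv_sorted_wrt)
  qed
  have "f \<in> strict_maps P r (n - 1)"
    unfolding strict_maps_def
  proof (intro CollectI conjI ballI impI PiE_I)
    fix x assume "x \<in> P"
    then obtain M where M: "M \<in> maximal_chains P r" "x \<in> M"
      using chain_subset_maximal_chain[OF P'(1,4), of "{x}"] P'(4) by (auto simp: refl_on_def)
    then obtain i where i: "i < length (chain_list r M)" "x = chain_list r M ! i"
      using chain_list(2)[OF P'(7) M(1)] by (metis in_set_conv_nth)
    \<comment> \<open>On the increasing chain through \<open>x\<close>, the bounds known at its two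
      ends confine \<open>f x\<close> to \<open>{1..n - 1}\<close>.\<close>
    have "f (hd (chain_list r M)) \<le> f x"
      using sorted[OF M(1)] i
      by (cases "i = 0") (auto simp: hd_conv_nth nonempty[OF M(1)] sorted_wrt_iff_nth_less less_imp_le)
    moreover have "f x \<le> f (last (chain_list r M))"
      using sorted[OF M(1)] i
      by (cases "i = length (chain_list r M) - 1")
        (auto simp: last_conv_nth nonempty[OF M(1)] sorted_wrt_iff_nth_less less_imp_le)
    ultimately show "f x \<in> {1..n - 1}" using hd[OF M(1)] last[OF M(1)] by auto
  next
    fix x y assume xy: "x \<in> P" "y \<in> P" "(x, y) \<in> r \<and> x \<noteq> y"
    \<comment> \<open>Comparable points form a chain and hence share a maximal chain. Antisymmetry
      puts \<open>x\<close> before \<open>y\<close> in its listing, where \<open>f\<close>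
      increases.\<close>
    then obtain M where M: "M \<in> maximal_chains P r" "x \<in> M" "y \<in> M"
      using chain_subset_maximal_chain[OF P'(1,4), of "{x, y}"] P'(4) by (auto simp: refl_on_def)
    note ch = chain_list[OF P'(7) M(1)]
    obtain i j where ij: "i < length (chain_list r M)" "x = chain_list r M ! i"
      "j < length (chain_list r M)" "y = chain_list r M ! j"
      using ch(2) M(2,3) by (metis in_set_conv_nth)
    have "\<not> j < i"
    proof
      assume "j < i"
      then have "(y, x) \<in> r" using ch(3) ij by (simp add: sorted_wrt_iff_nth_less)
      then show False using xy antisymD[OF P'(6), of x y] by blast
    qed
    then have "i < j" using ij xy by (cases "i = j") auto
    then show "f x < f y" using sorted[OF M(1)] ij by (simp add: sorted_wrt_iff_nth_less)
  qed (simp add: f_def)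
  then show ?thesis using \<phi> word unfolding encodes_def by blast
qed

section \<open>The bijection between strict maps and classes of shuffles\<close>

text \<open>Identified shuffles carry the same word for each maximal chain, the word determines the
  map on that chain, and the maximal chains cover \<open>P\<close>.\<close>

lemma encodes_inject:
  assumes P: "sp_poset P r" and ST: "(S, T) \<in> identified P r n"
    and S: "encodes P r n S f" and T: "encodes P r n T g"
    and f: "f \<in> strict_maps P r (n - 1)" and g: "g \<in> strict_maps P r (n - 1)"
  shows "f = g"
proof -
  note P' = sp_posetD[OF P]
  obtain \<phi> \<psi> where \<phi>: "chain_bijection P r n S \<phi>" and \<psi>: "chain_bijection P r n T \<psi>"
    and eq: "\<And>M. M \<in> maximal_chains P r \<Longrightarrow> label_seq S (\<phi> M) = label_seq T (\<psi> M)"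
    using ST unfolding identified_def by blast
  obtain \<phi>' where \<phi>': "chain_bijection P r n S \<phi>'"
    "\<And>M. M \<in> maximal_chains P r \<Longrightarrow> label_seq S (\<phi>' M) = deck_word f 0 n (chain_list r M)"
    using S unfolding encodes_def by blast
  obtain \<psi>' where \<psi>': "chain_bijection P r n T \<psi>'"
    "\<And>M. M \<in> maximal_chains P r \<Longrightarrow> label_seq T (\<psi>' M) = deck_word g 0 n (chain_list r M)"
    using T unfolding encodes_def by blast
  show ?thesis
  proof (rule PiE_ext)
    show "f \<in> P \<rightarrow>\<^sub>E {1..n - 1}" "g \<in> P \<rightarrow>\<^sub>E {1..n - 1}"
      using f g by (simp_all add: strict_maps_def)
    fix x assume "x \<in> P"
    then obtain M where M: "M \<in> maximal_chains P r" "x \<in> M"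
      using chain_subset_maximal_chain[OF P'(1,4), of "{x}"] P'(4) by (auto simp: refl_on_def)
    have sorted: "sorted_wrt (\<lambda>x y. h x \<le> h y) (chain_list r M)"
      if h: "h \<in> strict_maps P r (n - 1)" for h
    proof (rule sorted_wrt_mono_rel)
      show "sorted_wrt (\<lambda>x y. h x < h y) (chain_list r M)"
        using h maximal_chains_nonempty(2)[OF P M(1)]
        by (intro sorted_wrt_chain_list[OF P'(7) M(1)]) (simp_all add: strict_maps_def)
    qed simp
    \<comment> \<open>The chain bijections witnessing the encodings and the identification are
      obtained separately; \<open>chain_bijection_unique\<close> shows that they agree on
      \<open>M\<close>.\<close>
    have "deck_word f 0 n (chain_list r M) = deck_word g 0 n (chain_list r M)"
      using \<phi>'(2)[OF M(1)] \<psi>'(2)[OF M(1)] eq[OF M(1)]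
        chain_bijection_unique[OF P'(7) \<phi> \<phi>'(1) M(1)] chain_bijection_unique[OF P'(7) \<psi> \<psi>'(1) M(1)]
      by simp
    then show "f x = g x"
      by (rule deck_word_inject[OF _ sorted[OF f] sorted[OF g]])
        (simp_all add: chain_list(2)[OF P'(7) M(1)] M(2))
  qed
qed

theorem lemma3p20:
  fixes P :: "'a set" and r :: "'a rel" and n :: nat
  assumes "sp_poset P r"
  shows "finite (ldd_shuffles P r n // identified P r n) \<and>
         fps_nth (ldd_series P r) n = of_nat (card (ldd_shuffles P r n // identified P r n))"
proof -
  note P = sp_posetD[OF assms]
  note equiv = equiv_identified[OF P(7), of n]
  define F where "F = strict_maps P r (n - 1)"
  \<comment> \<open>An arbitrary shuffle encoding \<open>f\<close> is chosen; the choice is harmless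
    because only its class is counted.\<close>
  define shuffle where "shuffle f = (SOME S. S \<in> ldd_shuffles P r n \<and> encodes P r n S f)" for f
  have shuffle: "shuffle f \<in> ldd_shuffles P r n" "encodes P r n (shuffle f) f" if "f \<in> F" for f
    using someI_ex[of "\<lambda>S. S \<in> ldd_shuffles P r n \<and> encodes P r n S f"]
      exists_ldd_shuffle_encoding[OF assms, of f n] that unfolding F_def shuffle_def by blast+
  have colim: "colimit_shuffle P r n S" if "S \<in> ldd_shuffles P r n" for S
    using that by (simp add: ldd_shuffles_def)
  have "bij_betw (\<lambda>f. identified P r n `` {shuffle f}) F (ldd_shuffles P r n // identified P r n)"
    unfolding bij_betw_def
  proof (intro conjI inj_onI equalityI subsetI)
    fix f g assume fg: "f \<in> F" "g \<in> F"
      and "identified P r n `` {shuffle f} = identified P r n `` {shuffle g}"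
    then have "(shuffle f, shuffle g) \<in> identified P r n"
      using shuffle colim by (intro eq_equiv_class[OF _ equiv]) auto
    then show "f = g"
      using encodes_inject[OF assms _ shuffle(2) shuffle(2)] fg unfolding F_def by blast
  next
    fix c assume "c \<in> (\<lambda>f. identified P r n `` {shuffle f}) ` F"
    then show "c \<in> ldd_shuffles P r n // identified P r n"
      using shuffle(1) by (auto intro: quotientI)
  next
    fix c assume "c \<in> ldd_shuffles P r n // identified P r n"
    then obtain S where S: "S \<in> ldd_shuffles P r n" "c = identified P r n `` {S}"
      by (rule quotientE)
    then obtain f where f: "f \<in> F" "encodes P r n S f"
      using ldd_shuffle_encodes[OF assms] unfolding F_def by blast
    obtain \<phi> where \<phi>: "chain_bijection P r n S \<phi>"
      "\<And>M. M \<in> maximal_chains P r \<Longrightarrow> label_seq S (\<phi> M) = deck_word f 0 n (chain_list r M)"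
      using f(2) unfolding encodes_def by blast
    obtain \<psi> where \<psi>: "chain_bijection P r n (shuffle f) \<psi>"
      "\<And>M. M \<in> maximal_chains P r \<Longrightarrow> label_seq (shuffle f) (\<psi> M) = deck_word f 0 n (chain_list r M)"
      using shuffle(2)[OF f(1)] unfolding encodes_def by blast
    \<comment> \<open>Surjectivity: \<open>S\<close> and the chosen shuffle encode the same map, so
      both have the deck words of \<open>f\<close> as label sequences and are identified.\<close>
    have "(S, shuffle f) \<in> identified P r n"
    proof -
      have "\<forall>M\<in>maximal_chains P r. label_seq S (\<phi> M) = label_seq (shuffle f) (\<psi> M)"
        using \<phi>(2) \<psi>(2) by simp
      then show ?thesis
        unfolding identified_def
        using colim[OF S(1)] colim[OF shuffle(1)[OF f(1)]] \<phi>(1) \<psi>(1) by blast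
    qed
    then have "c = identified P r n `` {shuffle f}"
      using S(2) equiv_class_eq[OF equiv] by simp
    then show "c \<in> (\<lambda>f. identified P r n `` {shuffle f}) ` F" using f(1) by blast
  qed
  then have "finite (ldd_shuffles P r n // identified P r n)"
    and "card (ldd_shuffles P r n // identified P r n) = card F"
    using bij_betw_finite bij_betw_same_card finite_strict_maps[OF P(1)] unfolding F_def by metis+
  then show ?thesis
    using ldd_series_nth[OF P(1,2)] by (simp add: F_def)
qed

end
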